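(* Let $d\ge 2$ and consider random vectors $\boldsymbol{w}_1,\dots,\boldsymbol{w}_d\in\mathbb{R}^d$ of the form $\boldsymbol{w}_i=w_i\widehat{\boldsymbol{w}}_i$ where the norms $w_1,\dots,w_d$ are i.i.d. $\chi_d$-distributed, the unit directions $(\widehat{\boldsymbol{w}}_1,\dots,\widehat{\boldsymbol{w}}_d)$ are jointly distributed in an arbitrary way but independently of the norms, each $\boldsymbol{w}_i$ is marginally $\mathcal{N}(0,\mathbf{I}_d)$, and for each $i\ne j$ the law of $\boldsymbol{w}_i+\boldsymbol{w}_j$ is rotationally invariant (a weight-independent geometrical coupling). Among all such couplings, the simplex coupling (SimRFs) attains the smallest possible RF-conformity $\rho(\boldsymbol{x},\boldsymbol{y})$ for every $\boldsymbol{x},\boldsymbol{y}\in\mathbb{R}^d$, and hence the smallest possible mean squared error of the positive random feature estimator of $\exp(-\|\boldsymbol{x}-\boldsymbol{y}\|_2^2/2)$.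
   Context: PRF estimator: $\phi(\boldsymbol{z})=\frac{1}{\sqrt d}\exp(-\|\boldsymbol{z}\|_2^2)(\exp(\boldsymbol{w}_i^\top\boldsymbol{z}))_{i=1}^d$, $\widehat{K}(\boldsymbol{x},\boldsymbol{y})=\phi(\boldsymbol{x})^\top\phi(\boldsymbol{y})$, MSE $=\mathbb{E}[(\widehat K-\exp(-\|\boldsymbol{x}-\boldsymbol{y}\|_2^2/2))^2]$. RF-conformity (with $m=d$): $\rho(\boldsymbol{x},\boldsymbol{y})=\frac{\Gamma(d/2)}{m(m-1)}\sum_{i}\sum_{j\ne i}\mathbb{E}\big(\sum_{k\ge0}\frac{v^{2k}w_{ij}^{2k}}{2^{2k}k!\Gamma(k+d/2)}\big)$ with $w_{ij}=\|\boldsymbol{w}_i+\boldsymbol{w}_j\|_2$, $v=\|\boldsymbol{x}+\boldsymbol{y}\|_2$. SimRF coupling: $\boldsymbol{w}_i$ is the $i$-th row of $\mathrm{diag}(w_1,\dots,w_d)\mathbf{S}\mathbf{R}$, with $\mathbf{R}$ Haar-distributed on $\mathrm{O}(d)$ independent of the norms, and $\mathbf{S}$ having rows $\boldsymbol{s}_i=\sqrt{\frac{d}{d-1}}\mathbf{e}_i-\frac{\sqrt d+1}{(d-1)^{3/2}}(1,\dots,1,0)^\top$ ($1\le i<d$), $\boldsymbol{s}_d=\frac{1}{\sqrt{d-1}}(1,\dots,1,0)^\top$, so that the directions are unit vectors with pairwise inner products $-\frac{1}{d-1}$. *)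

theory Defs
  imports "HOL-Probability.Probability"
begin

text \<open>Dimension d = CARD('n). A d-tuple of vectors (w_1,...,w_d) in R^d is an element
  W :: (real^'n)^'n, with W $ i the i-th vector.\<close>

definition chi_measure :: "nat \<Rightarrow> real measure" where
  "chi_measure d = density lborel (\<lambda>r. ennreal (if r \<ge> 0 then
      r ^ (d - 1) * exp (- (r\<^sup>2) / 2) / (2 powr (real d / 2 - 1) * Gamma (real d / 2)) else 0))"

definition std_gauss :: "(real^'n::finite) measure" where
  "std_gauss = density lborel (\<lambda>z. ennreal ((2 * pi) powr (- real CARD('n) / 2) * exp (- (norm z)\<^sup>2 / 2)))"

definition coupled_measure :: "((real^'n::finite)^'n) measure \<Rightarrow> ((real^'n)^'n) measure" where
  "coupled_measure Q = distr ((PiM UNIV (\<lambda>_. chi_measure CARD('n))) \<Otimes>\<^sub>M Q) borel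
      (\<lambda>(r, u). \<chi> i. r i *\<^sub>R (u $ i))"

definition wig_coupling :: "((real^'n::finite)^'n) measure \<Rightarrow> bool" where
  "wig_coupling P \<longleftrightarrow>
     (\<exists>Q. prob_space Q \<and> sets Q = sets borel \<and> (AE u in Q. \<forall>i. norm (u $ i) = 1)
          \<and> P = coupled_measure Q)
   \<and> (\<forall>i. distr P borel (\<lambda>W. W $ i) = std_gauss)
   \<and> (\<forall>i j. i \<noteq> j \<longrightarrow> (\<forall>U :: real^'n^'n. orthogonal_matrix U \<longrightarrow>
          distr P borel (\<lambda>W. U *v (W $ i + W $ j)) = distr P borel (\<lambda>W. W $ i + W $ j)))"

definition haar_orthogonal :: "((real^('n::finite))^'n) measure \<Rightarrow> bool" where
  "haar_orthogonal H \<longleftrightarrow> prob_space H \<and> sets H = sets borel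
     \<and> (AE R in H. orthogonal_matrix R)
     \<and> (\<forall>U :: real^'n^'n. orthogonal_matrix U \<longrightarrow> distr H borel (\<lambda>R. U ** R) = H)"

text \<open>The simplex matrix S; the distinguished last coordinate d is Max UNIV.\<close>
definition ones_but_last :: "real^'n::{finite,linorder}" where
  "ones_but_last = (\<chi> k. if k = Max UNIV then 0 else 1)"

definition simplex_S :: "(real^('n::{finite,linorder}))^('n::{finite,linorder})" where
  "simplex_S = (\<chi> i::'n. if i = Max UNIV
      then (1 / sqrt (real CARD('n::{finite,linorder}) - 1)) *\<^sub>R ones_but_last
      else sqrt (real CARD('n::{finite,linorder}) / (real CARD('n::{finite,linorder}) - 1)) *\<^sub>R axis i 1
           - ((sqrt (real CARD('n::{finite,linorder})) + 1) / (real CARD('n::{finite,linorder}) - 1) powr (3/2)) *\<^sub>R ones_but_last)"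

text \<open>SimRF coupling: directions are the rows of S R with R Haar on O(d).\<close>
definition simrf :: "((real^('n::{finite,linorder}))^('n::{finite,linorder})) measure \<Rightarrow> ((real^('n::{finite,linorder}))^('n::{finite,linorder})) measure" where
  "simrf H = coupled_measure (distr H borel (\<lambda>R. simplex_S ** R))"

text \<open>RF-conformity (m = d), expectation as nonnegative integral.\<close>
definition rf_conformity :: "((real^'n::finite)^'n) measure \<Rightarrow> real^'n \<Rightarrow> real^'n \<Rightarrow> ennreal" where
  "rf_conformity P x y =
     ennreal (Gamma (real CARD('n) / 2) / (real CARD('n) * (real CARD('n) - 1))) *
     (\<Sum>i\<in>UNIV. \<Sum>j\<in>UNIV - {i}. \<integral>\<^sup>+ W. (\<Sum>k. ennreal (
        norm (x + y) ^ (2 * k) * norm (W $ i + W $ j) ^ (2 * k)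
        / (2 ^ (2 * k) * fact k * Gamma (real k + real CARD('n) / 2)))) \<partial>P)"

definition prf_phi :: "(real^'n::finite)^'n \<Rightarrow> real^'n \<Rightarrow> real^'n" where
  "prf_phi W z = (\<chi> i. (1 / sqrt (real CARD('n))) * exp (- (norm z)\<^sup>2) * exp ((W $ i) \<bullet> z))"

definition prf_K :: "(real^'n::finite)^'n \<Rightarrow> real^'n \<Rightarrow> real^'n \<Rightarrow> real" where
  "prf_K W x y = prf_phi W x \<bullet> prf_phi W y"

definition prf_mse :: "((real^'n::finite)^'n) measure \<Rightarrow> real^'n \<Rightarrow> real^'n \<Rightarrow> ennreal" where
  "prf_mse P x y = \<integral>\<^sup>+ W. ennreal ((prf_K W x y - exp (- (norm (x - y))\<^sup>2 / 2))\<^sup>2) \<partial>P"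

end

theory Submission
  imports Defs
begin

text \<open>Conditionally on the directions \<open>u\<close>, the moment \<open>E (norm (W i + W j) ^ (2 * k))\<close> is
  \<open>F\<^sub>k (u i \<bullet> u j)\<close>, where \<open>F\<^sub>k t\<close> is the expectation of
  \<open>(a\<^sup>2 + b\<^sup>2 + 2 * a * b * t) ^ k\<close> over two independent chi-distributed norms \<open>a\<close>, \<open>b\<close>. This is convex
  and increasing in \<open>t\<close> and independent of the pair. Since \<open>norm (\<Sum>i. u i)\<close> is nonnegative, the
  mean of \<open>u i \<bullet> u j\<close> over \<open>i \<noteq> j\<close> is at least \<open>- 1 / (d - 1)\<close>, so Jensen's inequality bounds the
  sum of the moments from below by its value when all these inner products equal \<open>- 1 / (d - 1)\<close>,
  which is the simplex. The conformity is a nonnegative combination of these moments; so is the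
  coupling-dependent part of the mean squared error, because averaging \<open>exp (w \<bullet> z)\<close> over
  rotations of \<open>w\<close> gives an even power series in \<open>norm w\<close> with nonnegative coefficients.\<close>

section \<open>Haar measure on the orthogonal group\<close>

lemma continuous_on_matrix_mult [continuous_intros]:
  fixes f g :: "'a::topological_space \<Rightarrow> real^'n^'n"
  assumes "continuous_on S f" "continuous_on S g"
  shows "continuous_on S (\<lambda>x. f x ** g x)"
  using assms unfolding matrix_matrix_mult_def by (intro continuous_intros)

lemma continuous_on_transpose [continuous_intros]:
  fixes f :: "'a::topological_space \<Rightarrow> real^'n^'n"
  assumes "continuous_on S f"
  shows "continuous_on S (\<lambda>x. transpose (f x))"
  using assms unfolding transpose_def by (intro continuous_intros)

lemma continuous_on_matrix_vector_mult_both [continuous_intros]: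
  fixes f :: "'a::topological_space \<Rightarrow> real^'n^'n"
  assumes "continuous_on S f" "continuous_on S g"
  shows "continuous_on S (\<lambda>x. f x *v g x)"
  using assms unfolding matrix_vector_mult_def by (intro continuous_intros)

lemma orthogonal_matrix_maps_equal_norm:
  fixes a b :: "real^'n"
  assumes "norm a = norm b"
  obtains U where "orthogonal_matrix U" "U *v a = b"
proof -
  obtain f where f: "orthogonal_transformation f" "f a = b"
    using orthogonal_transformation_exists[OF assms] .
  then have "matrix f *v a = b"
    by (simp add: matrix_works orthogonal_transformation_linear)
  then show thesis
    using f(1) that orthogonal_transformation_matrix by blast
qed

lemma orthogonal_matrix_norm:
  fixes U :: "real^'n^'n"
  assumes "orthogonal_matrix U"
  shows "norm (U *v a) = norm a"
  using assms orthogonal_transformation_matrix[of "\<lambda>x. U *v x"]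
  by (simp add: orthogonal_transformation_norm)

text \<open>Second countability makes the product sigma-algebra the Borel one, so joint
  measurability for the Fubini steps below reduces to continuity on the product space.\<close>

lemma measurable_pair_borel:
  fixes M :: "'a::second_countable_topology measure" and N :: "'b::second_countable_topology measure"
  assumes "sets M = sets borel" "sets N = sets borel"
  shows "measurable (M \<Otimes>\<^sub>M N) L = measurable borel L"
proof (rule measurable_cong_sets)
  show "sets (M \<Otimes>\<^sub>M N) = sets borel"
    using assms by (metis borel_prod sets_pair_measure_cong)
qed simp

lemma haar_left_invariant:
  fixes H :: "(real^'n::finite^'n) measure" and f :: "real^'n^'n \<Rightarrow> ennreal"
  assumes H: "haar_orthogonal H" and U: "orthogonal_matrix U" and f: "f \<in> borel_measurable borel"
  shows "(\<integral>\<^sup>+R. f (U ** R) \<partial>H) = (\<integral>\<^sup>+R. f R \<partial>H)"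
proof -
  have s: "sets H = sets borel" using H by (simp add: haar_orthogonal_def)
  have [measurable]: "(\<lambda>R. U ** R) \<in> borel_measurable H"
    using s by (auto intro!: borel_measurable_continuous_onI continuous_intros cong: measurable_cong_sets)
  have "(\<integral>\<^sup>+R. f R \<partial>H) = (\<integral>\<^sup>+R. f R \<partial>distr H borel (\<lambda>R. U ** R))"
    using H U by (simp add: haar_orthogonal_def)
  also have "\<dots> = (\<integral>\<^sup>+R. f (U ** R) \<partial>H)"
    by (rule nn_integral_distr) (use f in simp_all)
  finally show ?thesis by simp
qed

text \<open>The definition of Haar measure speaks of left multiplication; this is the bridge to
  right multiplication. Average over a second independent matrix \<open>S\<close> and replace
  \<open>R\<close> by \<open>transpose S ** R\<close>, using left invariance in \<open>R\<close>.
  After exchanging the integrals, \<open>transpose S ** R\<close> is the transpose of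
  \<open>transpose R ** S\<close>, and left invariance in \<open>S\<close> removes
  \<open>R\<close>.\<close>

lemma haar_transpose:
  fixes H :: "(real^'n::finite^'n) measure" and f :: "real^'n^'n \<Rightarrow> ennreal"
  assumes H: "haar_orthogonal H" and f[measurable]: "f \<in> borel_measurable borel"
  shows "(\<integral>\<^sup>+R. f (transpose R) \<partial>H) = (\<integral>\<^sup>+R. f R \<partial>H)"
proof -
  interpret prob_space H using H by (simp add: haar_orthogonal_def)
  interpret pair_sigma_finite H H by unfold_locales
  have s: "sets H = sets borel" using H by (simp add: haar_orthogonal_def)
  have orth: "AE R in H. orthogonal_matrix R" using H by (simp add: haar_orthogonal_def)
  have m0: "(\<lambda>p :: (real^'n^'n) \<times> (real^'n^'n). transpose (fst p) ** snd p) \<in> borel_measurable borel"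
    by (intro borel_measurable_continuous_onI continuous_intros)
  have m: "(\<lambda>(S, R). f (transpose S ** R)) \<in> borel_measurable (H \<Otimes>\<^sub>M H)"
    unfolding case_prod_unfold measurable_pair_borel[OF s s] by (rule measurable_compose[OF m0 f])
  have "(\<integral>\<^sup>+R. f R \<partial>H) = (\<integral>\<^sup>+S. (\<integral>\<^sup>+R. f R \<partial>H) \<partial>H)" by (simp add: emeasure_space_1)
  also have "\<dots> = (\<integral>\<^sup>+S. (\<integral>\<^sup>+R. f (transpose S ** R) \<partial>H) \<partial>H)"
    by (rule nn_integral_cong_AE, use orth in eventually_elim)
       (simp add: haar_left_invariant[OF H _ f] orthogonal_matrix_transpose)
  also have "\<dots> = (\<integral>\<^sup>+R. (\<integral>\<^sup>+S. f (transpose S ** R) \<partial>H) \<partial>H)"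
    using Fubini[OF m] by simp
  also have "\<dots> = (\<integral>\<^sup>+R. (\<integral>\<^sup>+S. f (transpose S) \<partial>H) \<partial>H)"
  proof (rule nn_integral_cong_AE, use orth in eventually_elim)
    fix R :: "real^'n^'n" assume R: "orthogonal_matrix R"
    have mt: "(\<lambda>S. f (transpose S)) \<in> borel_measurable borel"
      by (rule measurable_compose[OF _ f]) (intro borel_measurable_continuous_onI continuous_intros)
    have "(\<integral>\<^sup>+S. f (transpose (transpose R ** S)) \<partial>H) = (\<integral>\<^sup>+S. f (transpose S) \<partial>H)"
      using haar_left_invariant[OF H _ mt, of "transpose R"] R by (simp add: orthogonal_matrix_transpose)
    then show "(\<integral>\<^sup>+S. f (transpose S ** R) \<partial>H) = (\<integral>\<^sup>+S. f (transpose S) \<partial>H)"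
      by (simp add: matrix_transpose_mul)
  qed
  also have "\<dots> = (\<integral>\<^sup>+S. f (transpose S) \<partial>H)" by (simp add: emeasure_space_1)
  finally show ?thesis by simp
qed

text \<open>Transposition turns right multiplication by \<open>U\<close> into left multiplication by
  \<open>transpose U\<close>.\<close>

lemma haar_right_invariant:
  fixes H :: "(real^'n::finite^'n) measure" and f :: "real^'n^'n \<Rightarrow> ennreal"
  assumes H: "haar_orthogonal H" and U: "orthogonal_matrix U" and f[measurable]: "f \<in> borel_measurable borel"
  shows "(\<integral>\<^sup>+R. f (R ** U) \<partial>H) = (\<integral>\<^sup>+R. f R \<partial>H)"
proof -
  have m1: "(\<lambda>R. f (R ** U)) \<in> borel_measurable borel" and m2: "(\<lambda>R. f (transpose R)) \<in> borel_measurable borel"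
    by (rule measurable_compose[OF _ f], intro borel_measurable_continuous_onI continuous_intros)+
  have "(\<integral>\<^sup>+R. f (R ** U) \<partial>H) = (\<integral>\<^sup>+R. f (transpose (transpose U ** R)) \<partial>H)"
    using haar_transpose[OF H m1] by (simp add: matrix_transpose_mul)
  also have "\<dots> = (\<integral>\<^sup>+R. f (transpose R) \<partial>H)"
    using haar_left_invariant[OF H _ m2] U by (simp add: orthogonal_matrix_transpose)
  finally show ?thesis using haar_transpose[OF H f] by simp
qed

text \<open>Some orthogonal matrix carries \<open>a\<close> to \<open>b\<close>, and right
  invariance absorbs it. Haar averages along an orbit therefore see only the norm of the starting
  vector.\<close>

lemma haar_orbit:
  fixes H :: "(real^'n::finite^'n) measure" and f :: "real^'n \<Rightarrow> ennreal"
  assumes H: "haar_orthogonal H" and ab: "norm a = norm b" and f: "f \<in> borel_measurable borel"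
  shows "(\<integral>\<^sup>+R. f (R *v a) \<partial>H) = (\<integral>\<^sup>+R. f (R *v b) \<partial>H)"
proof -
  obtain U where U: "orthogonal_matrix U" "U *v a = b"
    using orthogonal_matrix_maps_equal_norm[OF ab] .
  have "(\<lambda>R. f (R *v a)) \<in> borel_measurable borel"
    by (rule measurable_compose[OF _ f]) (intro borel_measurable_continuous_onI continuous_intros)
  from haar_right_invariant[OF H U(1), of "\<lambda>R. f (R *v a)"] this
  have "(\<integral>\<^sup>+R. f (R *v a) \<partial>H) = (\<integral>\<^sup>+R. f ((R ** U) *v a) \<partial>H)" by simp
  then show ?thesis using U by (simp flip: matrix_vector_mul_assoc)
qed

section \<open>Rotation invariance of the Gaussian measure\<close>

lemma nn_integral_lborel_translate:
  fixes f :: "'a::euclidean_space \<Rightarrow> ennreal"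
  assumes [measurable]: "f \<in> borel_measurable borel"
  shows "(\<integral>\<^sup>+x. f (c + x) \<partial>lborel) = (\<integral>\<^sup>+x. f x \<partial>lborel)"
proof -
  have "(\<integral>\<^sup>+x. f x \<partial>lborel) = (\<integral>\<^sup>+x. f x \<partial>distr lborel borel ((+) c))"
    by (simp only: lborel_distr_plus)
  also have "\<dots> = (\<integral>\<^sup>+x. f (c + x) \<partial>lborel)"
    by (rule nn_integral_distr) simp_all
  finally show ?thesis by simp
qed

lemma nn_integral_lborel_reflect:
  fixes f :: "'a::euclidean_space \<Rightarrow> ennreal"
  assumes [measurable]: "f \<in> borel_measurable borel"
  shows "(\<integral>\<^sup>+x. f (c - x) \<partial>lborel) = (\<integral>\<^sup>+x. f x \<partial>lborel)"
proof -
  have "lborel = distr lborel borel (\<lambda>x::'a. c + (-1::real) *\<^sub>R x)"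
    using lborel_affine[of "-1" c] by (simp add: density_1)
  then have "(\<integral>\<^sup>+x. f x \<partial>lborel) = (\<integral>\<^sup>+x. f x \<partial>distr lborel borel (\<lambda>x::'a. c + (-1::real) *\<^sub>R x))"
    by simp
  also have "\<dots> = (\<integral>\<^sup>+x. f (c - x) \<partial>lborel)"
    by (subst nn_integral_distr) simp_all
  finally show ?thesis by simp
qed

text \<open>The change of variables theorem of the library for orthogonal maps needs a well-ordered
  index type. The uniqueness argument for Haar measure avoids it: multiply by the volume of the
  unit ball, which is invariant, and use Fubini together with translations and reflections.\<close>

lemma nn_integral_lborel_orthogonal:
  fixes U :: "real^'n^'n" and f :: "real^'n \<Rightarrow> ennreal"
  assumes U: "orthogonal_matrix U" and f[measurable]: "f \<in> borel_measurable borel"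
  shows "(\<integral>\<^sup>+x. f (U *v x) \<partial>lborel) = (\<integral>\<^sup>+x. f x \<partial>lborel)"
proof -
  define g :: "real^'n \<Rightarrow> ennreal" where "g = indicator (cball 0 1)"
  have [measurable]: "g \<in> borel_measurable borel" by (simp add: g_def borel_measurable_indicator borel_closed)
  have mU[measurable]: "(\<lambda>x. U *v x) \<in> borel_measurable borel"
    by (intro borel_measurable_continuous_onI continuous_intros)
  have gU: "g (U *v x) = g x" for x
    using orthogonal_matrix_norm[OF U, of x] by (simp add: g_def indicator_def)
  have UT: "U *v (transpose U *v x) = x" for x
    using U by (simp add: matrix_vector_mul_assoc orthogonal_matrix_def del: transpose_matrix_vector)
  let ?V = "\<integral>\<^sup>+y. g y \<partial>lborel"
  have V: "?V \<noteq> 0" "?V \<noteq> \<infinity>"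
    using less_imp_neq[OF unit_ball_vol_pos[of "real CARD('n)"]] by (auto simp: g_def emeasure_cball)
  have "(\<integral>\<^sup>+x. f (U *v x) \<partial>lborel) * ?V = (\<integral>\<^sup>+x. (\<integral>\<^sup>+y. f (U *v x) * g (U *v x + y) \<partial>lborel) \<partial>lborel)"
    by (simp add: nn_integral_cmult nn_integral_lborel_translate nn_integral_multc)
  also have "\<dots> = (\<integral>\<^sup>+y. (\<integral>\<^sup>+x. f (U *v x) * g (U *v x + y) \<partial>lborel) \<partial>lborel)"
    by (rule lborel_pair.Fubini'[symmetric]) measurable
  also have "\<dots> = (\<integral>\<^sup>+y. (\<integral>\<^sup>+x. f (U *v x - y) * g (U *v x) \<partial>lborel) \<partial>lborel)"
  proof (rule nn_integral_cong)
    fix y :: "real^'n"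
    have "(\<lambda>x. f (U *v x) * g (U *v x + y)) \<in> borel_measurable borel" by measurable
    \<comment> \<open>The shift is chosen so that \<open>U\<close> maps it to \<open>- y\<close>: it
      moves \<open>y\<close> from the argument of \<open>g\<close> to that of \<open>f\<close>,
      where the later integration over \<open>y\<close> is a reflection.\<close>
    from nn_integral_lborel_translate[OF this, of "- (transpose U *v y)"]
    show "(\<integral>\<^sup>+x. f (U *v x) * g (U *v x + y) \<partial>lborel) = (\<integral>\<^sup>+x. f (U *v x - y) * g (U *v x) \<partial>lborel)"
      by (simp add: matrix_vector_right_distrib matrix_vector_mult_diff_distrib UT del: transpose_matrix_vector)
  qed
  also have "\<dots> = (\<integral>\<^sup>+x. (\<integral>\<^sup>+y. f (U *v x - y) * g (U *v x) \<partial>lborel) \<partial>lborel)"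
    by (rule lborel_pair.Fubini') measurable
  also have "\<dots> = (\<integral>\<^sup>+x. f x \<partial>lborel) * ?V"
    by (simp add: nn_integral_cmult nn_integral_lborel_reflect nn_integral_multc gU)
  \<comment> \<open>The ball volume is positive and finite, hence can be cancelled.\<close>
  finally show ?thesis using V
    by (metis ennreal_mult_cancel_left mult.commute infinity_ennreal_def)
qed

lemma std_gauss_sets [simp, measurable_cong]: "sets (std_gauss :: (real^'n::finite) measure) = sets borel"
  by (simp add: std_gauss_def)

lemma nn_integral_std_gauss:
  fixes f :: "real^'n \<Rightarrow> ennreal"
  assumes [measurable]: "f \<in> borel_measurable borel"
  shows "(\<integral>\<^sup>+x. f x \<partial>std_gauss) = (\<integral>\<^sup>+z. ennreal ((2 * pi) powr (- real CARD('n) / 2) * exp (- (norm z)\<^sup>2 / 2)) * f z \<partial>lborel)"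
  unfolding std_gauss_def by (subst nn_integral_density) simp_all

text \<open>The density depends on the norm alone, so the rotation invariance of Lebesgue measure
  carries over.\<close>

lemma std_gauss_orthogonal:
  fixes U :: "real^'n^'n" and f :: "real^'n \<Rightarrow> ennreal"
  assumes U: "orthogonal_matrix U" and f[measurable]: "f \<in> borel_measurable borel"
  shows "(\<integral>\<^sup>+x. f (U *v x) \<partial>std_gauss) = (\<integral>\<^sup>+x. f x \<partial>std_gauss)"
proof -
  have [measurable]: "(\<lambda>x. U *v x) \<in> borel_measurable borel"
    by (intro borel_measurable_continuous_onI continuous_intros)
  show ?thesis
    using nn_integral_lborel_orthogonal[OF U, of "\<lambda>z. ennreal ((2 * pi) powr (- real CARD('n) / 2) * exp (- (norm z)\<^sup>2 / 2)) * f z"]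
    by (simp add: nn_integral_std_gauss orthogonal_matrix_norm[OF U])
qed

text \<open>The density factors over the standard basis into one-dimensional normal densities, each
  of total mass 1.\<close>

lemma prob_space_std_gauss: "prob_space (std_gauss :: (real^'n::finite) measure)"
proof
  have 1: "(\<integral>\<^sup>+x. ennreal (normal_density 0 1 x) \<partial>lborel) = 1"
    using prob_space.emeasure_space_1[OF prob_space_normal_density[of 1 0]]
    by (simp add: emeasure_density)
  have norm2: "(norm z)\<^sup>2 = (\<Sum>b\<in>Basis. (z \<bullet> b)\<^sup>2)" for z :: "real^'n"
    unfolding power2_norm_eq_inner by (subst euclidean_inner) (simp add: power2_eq_square)
  have e: "(2 * pi) powr (- real CARD('n) / 2) * exp (- (norm z)\<^sup>2 / 2) = (\<Prod>b\<in>Basis. normal_density 0 1 (z \<bullet> b))" for z :: "real^'n"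
  proof -
    have "(\<Prod>b\<in>Basis. normal_density 0 1 (z \<bullet> b)) = (1 / sqrt (2 * pi)) ^ CARD('n) * exp (\<Sum>b\<in>Basis. - ((z \<bullet> b)\<^sup>2 / 2))"
      by (simp add: normal_density_def prod.distrib prod_dividef exp_sum power_divide)
    moreover have "(1 / sqrt (2 * pi)) ^ CARD('n) = (2 * pi) powr (- real CARD('n) / 2)"
    proof -
      have "1 / sqrt (2 * pi) = (2 * pi) powr (- 1 / 2)"
        by (simp add: powr_half_sqrt[symmetric] powr_minus_divide)
      then have "(1 / sqrt (2 * pi)) ^ CARD('n) = ((2 * pi) powr (- 1 / 2)) powr real CARD('n)"
        by (simp add: powr_realpow)
      then show ?thesis by (simp add: powr_powr)
    qed
    ultimately show ?thesis
      by (simp add: norm2 sum_negf sum_divide_distrib)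
  qed
  have "emeasure (std_gauss :: (real^'n) measure) (space std_gauss) = (\<integral>\<^sup>+z. (\<Prod>b\<in>Basis. ennreal (normal_density 0 1 ((z :: real^'n) \<bullet> b))) \<partial>lborel)"
    unfolding std_gauss_def by (subst emeasure_density) (simp_all only: e, simp_all add: prod_ennreal)
  also have "\<dots> = (\<Prod>b\<in>(Basis :: (real^'n) set). (\<integral>\<^sup>+x. ennreal (normal_density 0 1 x) \<partial>lborel))"
    by (rule nn_integral_lborel_prod) simp_all
  finally show "emeasure (std_gauss :: (real^'n) measure) (space std_gauss) = 1"
    by (simp add: 1)
qed

text \<open>Completing the square: tilting the density by \<open>exp (w \<bullet> z)\<close>
  translates it by \<open>z\<close> and multiplies it by \<open>exp ((norm z)\<^sup>2 / 2)\<close>.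
  Finiteness is what later allows the cross term of the squared error to be cancelled.\<close>

lemma std_gauss_mgf_finite:
  fixes z :: "real^'n::finite"
  shows "(\<integral>\<^sup>+w. ennreal (exp (w \<bullet> z)) \<partial>std_gauss) < \<infinity>"
proof -
  let ?c = "(2 * pi) powr (- real CARD('n) / 2)"
  have "(\<integral>\<^sup>+w. ennreal (exp (w \<bullet> z)) \<partial>std_gauss)
      = (\<integral>\<^sup>+w. ennreal (exp ((norm z)\<^sup>2 / 2)) * ennreal (?c * exp (- (norm (- z + w))\<^sup>2 / 2)) \<partial>lborel)"
  proof (subst nn_integral_std_gauss, simp, rule nn_integral_cong)
    fix w :: "real^'n"
    have "(norm (- z + w))\<^sup>2 = (norm z)\<^sup>2 - 2 * (w \<bullet> z) + (norm w)\<^sup>2"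
      by (simp add: power2_norm_eq_inner inner_simps inner_commute)
    then have "exp ((norm z)\<^sup>2 / 2) * exp (- (norm (- z + w))\<^sup>2 / 2) = exp (- (norm w)\<^sup>2 / 2) * exp (w \<bullet> z)"
      by (simp flip: exp_add) (simp add: field_simps)
    then show "ennreal (?c * exp (- (norm w)\<^sup>2 / 2)) * ennreal (exp (w \<bullet> z)) =
        ennreal (exp ((norm z)\<^sup>2 / 2)) * ennreal (?c * exp (- (norm (- z + w))\<^sup>2 / 2))"
      by (simp flip: ennreal_mult add: mult.assoc mult.left_commute)
  qed
  also have "\<dots> = ennreal (exp ((norm z)\<^sup>2 / 2)) * (\<integral>\<^sup>+w. ennreal (?c * exp (- (norm (- z + w))\<^sup>2 / 2)) \<partial>lborel)"
    by (rule nn_integral_cmult) simp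
  also have "(\<integral>\<^sup>+w. ennreal (?c * exp (- (norm (- z + w))\<^sup>2 / 2)) \<partial>lborel) = (\<integral>\<^sup>+w. ennreal (?c * exp (- (norm w)\<^sup>2 / 2)) \<partial>(lborel :: (real^'n) measure))"
    by (rule nn_integral_lborel_translate) simp
  also have "\<dots> = 1"
    using nn_integral_std_gauss[of "\<lambda>_::real^'n. 1"] prob_space.emeasure_space_1[OF prob_space_std_gauss[where ?'n='n]]
    by simp
  finally show ?thesis by simp
qed

section \<open>The norm of a Gaussian vector\<close>

text \<open>Integration in polar coordinates for radial functions. Both measures are compared on the
  half-lines \<open>{..a}\<close>: the left one gives the volume of the ball of radius
  \<open>a\<close>, the right one integrates the derivative of
  \<open>unit_ball_vol DIM('a) * r ^ DIM('a)\<close>.\<close>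

lemma distr_lborel_norm:
  "distr (lborel :: 'a::euclidean_space measure) borel norm =
     density lborel (\<lambda>r. ennreal (if r \<ge> 0 then real DIM('a) * unit_ball_vol DIM('a) * r ^ (DIM('a) - 1) else 0))"
    (is "?M = density lborel (\<lambda>r. ennreal (?f r))")
proof (rule measure_eqI_generator_eq)
  let ?E = "range (\<lambda>a::real. {..a})"
  show "Int_stable ?E"
    by (auto simp: Int_stable_def)
  have fm[measurable]: "?f \<in> borel_measurable borel" by measurable
  have N: "emeasure (density lborel (\<lambda>r. ennreal (?f r))) {..a}
      = (if a \<ge> 0 then ennreal (unit_ball_vol DIM('a) * a ^ DIM('a)) else 0)" for a
  proof -
    have "emeasure (density lborel (\<lambda>r. ennreal (?f r))) {..a} = (\<integral>\<^sup>+r. ennreal (?f r) * indicator {..a} r \<partial>lborel)"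
      by (simp add: emeasure_density)
    also have "\<dots> = (\<integral>\<^sup>+r. ennreal (real DIM('a) * unit_ball_vol DIM('a) * r ^ (DIM('a) - 1)) * indicator {0..a} r \<partial>lborel)"
      by (rule nn_integral_cong) (auto simp: indicator_def)
    also have "\<dots> = (if a \<ge> 0 then ennreal (unit_ball_vol DIM('a) * a ^ DIM('a)) else 0)"
    proof (cases "a \<ge> 0")
      case True
      have "(\<integral>\<^sup>+r. ennreal (real DIM('a) * unit_ball_vol DIM('a) * r ^ (DIM('a) - 1)) * indicator {0..a} r \<partial>lborel)
          = ennreal (unit_ball_vol DIM('a) * a ^ DIM('a) - unit_ball_vol DIM('a) * 0 ^ DIM('a))"
        by (rule nn_integral_FTC_Icc[where F = "\<lambda>r. unit_ball_vol DIM('a) * r ^ DIM('a)"])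
           (use True in \<open>auto intro!: derivative_eq_intros\<close>)
      then show ?thesis using True by (simp add: zero_power)
    qed auto
    finally show ?thesis .
  qed
  have M: "emeasure ?M {..a} = (if a \<ge> 0 then ennreal (unit_ball_vol DIM('a) * a ^ DIM('a)) else 0)" for a
  proof -
    have "norm -` {..a} = (cball 0 a :: 'a set)" by auto
    then have "emeasure ?M {..a} = emeasure lborel (cball 0 a :: 'a set)"
      by (simp add: emeasure_distr)
    then show ?thesis by (auto simp: emeasure_cball)
  qed
  show "emeasure ?M X = emeasure (density lborel (\<lambda>r. ennreal (?f r))) X" if "X \<in> ?E" for X
    using that M N by auto
  show "sets ?M = sigma_sets UNIV ?E" "sets (density lborel (\<lambda>r. ennreal (?f r))) = sigma_sets UNIV ?E"
    by (simp_all add: borel_eq_atMost)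
  show "range (\<lambda>i::nat. {..real i}) \<subseteq> ?E" by auto
  show "(\<Union>i::nat. {..real i}) = UNIV"
    using real_arch_simple by auto
  show "emeasure ?M {..real i} \<noteq> \<infinity>" for i :: nat
    using M[of "real i"] by simp
qed simp

text \<open>The Gaussian density is a function of the norm, so it passes through the push-forward of
  Lebesgue measure under the norm. What remains is to match the normalising constants.\<close>

lemma norm_std_gauss:
  "distr (std_gauss :: (real^'n::finite) measure) borel norm = chi_measure CARD('n)"
proof -
  let ?d = "real CARD('n)"
  let ?g = "\<lambda>r::real. ennreal ((2 * pi) powr (- ?d / 2) * exp (- r\<^sup>2 / 2))"
  have "distr (std_gauss :: (real^'n) measure) borel norm = density (distr lborel borel (norm :: real^'n \<Rightarrow> real)) ?g"
    unfolding std_gauss_def by (rule density_distr[symmetric]) simp_all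
  also have "\<dots> = density lborel (\<lambda>r. ennreal (if r \<ge> 0 then ?d * unit_ball_vol ?d * r ^ (CARD('n) - 1) else 0) * ?g r)"
    unfolding distr_lborel_norm DIM_cart DIM_real mult_1_right by (subst density_density_eq) simp_all
  also have "\<dots> = chi_measure CARD('n)"
    unfolding chi_measure_def
  proof (intro arg_cong[where f = "density lborel"] ext)
    fix r :: real
    \<comment> \<open>The ball volume contains \<open>Gamma (?d / 2 + 1)\<close>; the functional
      equation of Gamma cancels the factor \<open>?d\<close>, and the powers of \<open>pi\<close>
      cancel as well.\<close>
    have "?d * unit_ball_vol ?d * (2 * pi) powr (- ?d / 2) = 1 / (2 powr (?d / 2 - 1) * Gamma (?d / 2))"
    proof -
      have G: "Gamma (?d / 2 + 1) = (?d / 2) * Gamma (?d / 2)"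
        by (rule Gamma_plus1) (use nonpos_Ints_nonpos[of "?d / 2"] in force)
      define q where "q = 2 powr (?d / 2 - 1)"
      have P: "(2 * pi) powr (- ?d / 2) = 1 / (2 * q * pi powr (?d / 2))"
      proof -
        have "2 powr (?d / 2) = 2 * q" by (simp only: q_def powr_diff) simp
        then show ?thesis by (simp add: powr_mult powr_minus divide_simps)
      qed
      have "Gamma (?d / 2) > 0" by (rule Gamma_real_pos) simp
      then show ?thesis
        unfolding unit_ball_vol_def G P q_def[symmetric] by (simp add: divide_simps)
    qed
    note const = this
    have "?d * unit_ball_vol ?d * r ^ (CARD('n) - 1) * ((2 * pi) powr (- ?d / 2) * exp (- r\<^sup>2 / 2))
        = r ^ (CARD('n) - 1) * exp (- (r\<^sup>2) / 2) / (2 powr (?d / 2 - 1) * Gamma (?d / 2))"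
    proof -
      have "a * b * R * (c * e) = R * e / D" if "a * b * c = 1 / D" for a b c e R D :: real
      proof -
        have "a * b * R * (c * e) = a * b * c * (R * e)" by simp
        then show ?thesis by (simp add: that)
      qed
      from this[OF const] show ?thesis .
    qed
    then show "ennreal (if r \<ge> 0 then ?d * unit_ball_vol ?d * r ^ (CARD('n) - 1) else 0) * ?g r =
       ennreal (if 0 \<le> r then r ^ (CARD('n) - 1) * exp (- r\<^sup>2 / 2) / (2 powr (?d / 2 - 1) * Gamma (?d / 2)) else 0)"
      by (auto simp flip: ennreal_mult)
  qed
  finally show ?thesis .
qed

lemma chi_measure_sets [simp, measurable_cong]: "sets (chi_measure d) = sets borel"
  by (simp add: chi_measure_def)

text \<open>Total mass 1 is inherited from the Gaussian law, which spares the evaluation of a Gamma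
  integral.\<close>

lemma prob_space_chi: "prob_space (chi_measure CARD('n::finite))"
proof -
  interpret prob_space "std_gauss :: (real^'n) measure" by (rule prob_space_std_gauss)
  show ?thesis
    unfolding norm_std_gauss[symmetric] by (rule prob_space_distr) simp
qed

lemma AE_chi_nonneg: "AE r in chi_measure d. 0 \<le> r"
  unfolding chi_measure_def by (subst AE_density) (auto intro!: AE_I2 split: if_splits)

lemma nn_integral_chi:
  assumes [measurable]: "f \<in> borel_measurable borel"
  shows "(\<integral>\<^sup>+r. f r \<partial>chi_measure CARD('n::finite)) = (\<integral>\<^sup>+g. f (norm (g :: real^'n)) \<partial>std_gauss)"
  unfolding norm_std_gauss[symmetric] by (subst nn_integral_distr) simp_all

lemma haar_transpose_vector:
  fixes H :: "(real^'n::finite^'n) measure" and f :: "real^'n \<Rightarrow> ennreal"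
  assumes H: "haar_orthogonal H" and f: "f \<in> borel_measurable borel"
  shows "(\<integral>\<^sup>+R. f (transpose R *v a) \<partial>H) = (\<integral>\<^sup>+R. f (R *v a) \<partial>H)"
proof -
  have "(\<lambda>R. f (R *v a)) \<in> borel_measurable borel"
    by (rule measurable_compose[OF _ f]) (intro borel_measurable_continuous_onI continuous_intros)
  from haar_transpose[OF H this] show ?thesis .
qed

text \<open>Rotating a Gaussian vector by an independent Haar matrix does not change its law, but turns
  its direction into an independent uniform one; so the polar decomposition of the Gaussian law
  follows from the law of the norm alone.\<close>

lemma chi_times_haar_direction:
  fixes H :: "(real^'n::finite^'n) measure" and f :: "real^'n \<Rightarrow> ennreal"
  assumes H: "haar_orthogonal H" and s: "norm s = 1" and f[measurable]: "f \<in> borel_measurable borel"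
  shows "(\<integral>\<^sup>+r. (\<integral>\<^sup>+R. f (r *\<^sub>R (transpose R *v s)) \<partial>H) \<partial>chi_measure CARD('n)) = (\<integral>\<^sup>+w. f w \<partial>std_gauss)"
proof -
  interpret H: prob_space H using H by (simp add: haar_orthogonal_def)
  interpret G: prob_space "std_gauss :: (real^'n) measure" by (rule prob_space_std_gauss)
  interpret pair_sigma_finite "std_gauss :: (real^'n) measure" H by unfold_locales
  have sH: "sets H = sets borel" using H by (simp add: haar_orthogonal_def)
  have m: "(\<lambda>p :: (real^'n) \<times> (real^'n^'n). f (snd p *v fst p)) \<in> borel_measurable borel"
    by (rule measurable_compose[OF _ f]) (intro borel_measurable_continuous_onI continuous_intros)
  have m': "(\<lambda>(g, R). f (R *v g)) \<in> borel_measurable (std_gauss \<Otimes>\<^sub>M H)"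
    unfolding case_prod_unfold measurable_pair_borel[OF std_gauss_sets sH] by (rule m)
  have m2: "(\<lambda>p :: real \<times> (real^'n^'n). f (fst p *\<^sub>R (transpose (snd p) *v s))) \<in> borel_measurable borel"
    by (rule measurable_compose[OF _ f]) (intro borel_measurable_continuous_onI continuous_intros)
  have "(\<lambda>(r, R). f (r *\<^sub>R (transpose R *v s))) \<in> borel_measurable (borel \<Otimes>\<^sub>M H)"
    unfolding case_prod_unfold measurable_pair_borel[OF refl sH] by (rule m2)
  from H.borel_measurable_nn_integral[OF this]
  have "(\<integral>\<^sup>+r. (\<integral>\<^sup>+R. f (r *\<^sub>R (transpose R *v s)) \<partial>H) \<partial>chi_measure CARD('n))
      = (\<integral>\<^sup>+g. (\<integral>\<^sup>+R. f (norm (g :: real^'n) *\<^sub>R (transpose R *v s)) \<partial>H) \<partial>std_gauss)"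
    by (rule nn_integral_chi)
  also have "\<dots> = (\<integral>\<^sup>+g. (\<integral>\<^sup>+R. f (R *v (norm (g :: real^'n) *\<^sub>R s)) \<partial>H) \<partial>std_gauss)"
  proof (rule nn_integral_cong)
    fix g :: "real^'n"
    have "(\<integral>\<^sup>+R. f (transpose R *v (norm g *\<^sub>R s)) \<partial>H) = (\<integral>\<^sup>+R. f (R *v (norm g *\<^sub>R s)) \<partial>H)"
      by (rule haar_transpose_vector[OF H f])
    then show "(\<integral>\<^sup>+R. f (norm g *\<^sub>R (transpose R *v s)) \<partial>H) = (\<integral>\<^sup>+R. f (R *v (norm g *\<^sub>R s)) \<partial>H)"
      by (simp only: matrix_vector_mult_scaleR)
  qed
  \<comment> \<open>\<open>norm g *\<^sub>R s\<close> and \<open>g\<close> have equal norm and hence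
    the same Haar average; this is where the fixed direction \<open>s\<close> disappears.\<close>
  also have "\<dots> = (\<integral>\<^sup>+g. (\<integral>\<^sup>+R. f (R *v g) \<partial>H) \<partial>std_gauss)"
    by (intro nn_integral_cong haar_orbit[OF H _ f]) (simp add: s)
  also have "\<dots> = (\<integral>\<^sup>+R. (\<integral>\<^sup>+g. f (R *v g) \<partial>std_gauss) \<partial>H)"
    using Fubini[OF m'] by simp
  also have "\<dots> = (\<integral>\<^sup>+R. (\<integral>\<^sup>+g. f g \<partial>std_gauss) \<partial>H)"
  proof -
    have "AE R in H. orthogonal_matrix R" using H by (simp add: haar_orthogonal_def)
    then show ?thesis
      by (intro nn_integral_cong_AE, elim eventually_mono) (rule std_gauss_orthogonal[OF _ f])
  qed
  also have "\<dots> = (\<integral>\<^sup>+g. f g \<partial>std_gauss)" by (simp add: H.emeasure_space_1)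
  finally show ?thesis .
qed

section \<open>Moments of pair sums\<close>

abbreviation chi_norms :: "('n::finite \<Rightarrow> real) measure" where
  "chi_norms \<equiv> PiM UNIV (\<lambda>_::'n. chi_measure CARD('n))"

lemma prob_space_chi_norms: "prob_space (chi_norms :: ('n::finite \<Rightarrow> real) measure)"
  by (intro prob_space_PiM prob_space_chi)

text \<open>Checked entry by entry: each entry is the product of a coordinate projection of the
  product space and a continuous function of \<open>u\<close>.\<close>

lemma measurable_scale_rows:
  assumes sQ: "sets Q = sets (borel :: (real^'n::finite^'n) measure)"
  shows "(\<lambda>(r, u). \<chi> i. r i *\<^sub>R (u $ i)) \<in> borel_measurable ((chi_norms :: ('n \<Rightarrow> real) measure) \<Otimes>\<^sub>M Q)"
proof (subst borel_measurable_euclidean_space, rule ballI)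
  fix B :: "real^'n^'n" assume "B \<in> Basis"
  then obtain i b where B: "B = axis i b" by (auto simp: Basis_vec_def)
  have "(\<lambda>u :: real^'n^'n. u $ i \<bullet> b) \<in> borel_measurable borel"
    by (intro borel_measurable_continuous_onI continuous_intros)
  then have [measurable]: "(\<lambda>u. u $ i \<bullet> b) \<in> borel_measurable Q"
    using sQ measurable_cong_sets[OF sQ refl] by blast
  have "(\<lambda>x. fst x i * (snd x $ i \<bullet> b)) \<in> borel_measurable ((chi_norms :: ('n \<Rightarrow> real) measure) \<Otimes>\<^sub>M Q)"
    by measurable
  then show "(\<lambda>x. (case x of (r, u) \<Rightarrow> \<chi> i. r i *\<^sub>R (u $ i)) \<bullet> B) \<in> borel_measurable ((chi_norms :: ('n \<Rightarrow> real) measure) \<Otimes>\<^sub>M Q)"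
    by (simp add: B inner_axis case_prod_unfold)
qed

text \<open>Both orders of integration are needed. Fixing the directions first gives the pair
  moments as functions of inner products; fixing the norms first lets Haar invariance act on the
  simplex directions.\<close>

lemma nn_integral_coupled:
  fixes Q :: "(real^'n::finite^'n) measure" and f :: "real^'n^'n \<Rightarrow> ennreal"
  assumes "prob_space Q" and sQ: "sets Q = sets borel" and f: "f \<in> borel_measurable borel"
  shows "(\<integral>\<^sup>+W. f W \<partial>coupled_measure Q) = (\<integral>\<^sup>+u. (\<integral>\<^sup>+r. f (\<chi> i. r i *\<^sub>R (u $ i)) \<partial>chi_norms) \<partial>Q)"
    and "(\<integral>\<^sup>+W. f W \<partial>coupled_measure Q) = (\<integral>\<^sup>+r. (\<integral>\<^sup>+u. f (\<chi> i. r i *\<^sub>R (u $ i)) \<partial>Q) \<partial>chi_norms)"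
proof -
  interpret Q: prob_space Q by fact
  interpret C: prob_space "chi_norms :: ('n \<Rightarrow> real) measure" by (rule prob_space_chi_norms)
  interpret pair_sigma_finite "chi_norms :: ('n \<Rightarrow> real) measure" Q by unfold_locales
  note m = measurable_scale_rows[OF sQ]
  have mf: "(\<lambda>(r, u). f (\<chi> i. r i *\<^sub>R (u $ i))) \<in> borel_measurable (chi_norms \<Otimes>\<^sub>M Q)"
    using measurable_compose[OF m f] by (simp add: case_prod_unfold)
  have "(\<integral>\<^sup>+W. f W \<partial>coupled_measure Q) = (\<integral>\<^sup>+p. (case p of (r, u) \<Rightarrow> f (\<chi> i. r i *\<^sub>R (u $ i))) \<partial>(chi_norms \<Otimes>\<^sub>M Q))"
    unfolding coupled_measure_def by (subst nn_integral_distr[OF m]) (simp_all add: f case_prod_unfold)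
  then show "(\<integral>\<^sup>+W. f W \<partial>coupled_measure Q) = (\<integral>\<^sup>+u. (\<integral>\<^sup>+r. f (\<chi> i. r i *\<^sub>R (u $ i)) \<partial>chi_norms) \<partial>Q)"
    and "(\<integral>\<^sup>+W. f W \<partial>coupled_measure Q) = (\<integral>\<^sup>+r. (\<integral>\<^sup>+u. f (\<chi> i. r i *\<^sub>R (u $ i)) \<partial>Q) \<partial>chi_norms)"
    using nn_integral_snd[OF mf] Q.nn_integral_fst[OF mf] by (simp_all add: case_prod_unfold)
qed

lemma sets_coupled [simp]: "sets (coupled_measure Q) = sets borel"
  by (simp add: coupled_measure_def)

lemma prob_space_coupled:
  fixes Q :: "(real^'n::finite^'n) measure"
  assumes "prob_space Q" and sQ: "sets Q = sets borel"
  shows "prob_space (coupled_measure Q)"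
proof -
  interpret Q: prob_space Q by fact
  interpret C: prob_space "chi_norms :: ('n \<Rightarrow> real) measure" by (rule prob_space_chi_norms)
  interpret pair_prob_space "chi_norms :: ('n \<Rightarrow> real) measure" Q by unfold_locales
  show ?thesis
    unfolding coupled_measure_def by (rule prob_space_distr) (rule measurable_scale_rows[OF sQ])
qed

text \<open>The two norms are indexed by a two-element product space, so that every pair
  \<open>i \<noteq> j\<close> of norms gives literally the same function of \<open>u\<^sub>i \<bullet> u\<^sub>j\<close>.\<close>

definition pair_moment :: "nat \<Rightarrow> nat \<Rightarrow> real \<Rightarrow> ennreal" where
  "pair_moment d k t = (\<integral>\<^sup>+q. ennreal (((q True)\<^sup>2 + (q False)\<^sup>2 + 2 * q True * q False * t) ^ k)
      \<partial>PiM (UNIV :: bool set) (\<lambda>_. chi_measure d))"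

text \<open>Reindexing an i.i.d. product along the injection of \<open>bool\<close> onto
  \<open>i\<close> and \<open>j\<close> again gives an i.i.d. product.\<close>

lemma nn_integral_chi_norms_pair:
  fixes g :: "real \<Rightarrow> real \<Rightarrow> ennreal" and i j :: "'n::finite"
  assumes ij: "i \<noteq> j" and g: "(\<lambda>p. g (fst p) (snd p)) \<in> borel_measurable (borel \<Otimes>\<^sub>M borel)"
  shows "(\<integral>\<^sup>+r. g (r i) (r j) \<partial>chi_norms) = (\<integral>\<^sup>+q. g (q True) (q False) \<partial>PiM (UNIV :: bool set) (\<lambda>_. chi_measure CARD('n)))"
proof -
  let ?B = "PiM (UNIV :: bool set) (\<lambda>_. chi_measure CARD('n))"
  let ?f = "\<lambda>b. if b then i else j"
  have m: "(\<lambda>r. \<lambda>b\<in>UNIV. r (?f b)) \<in> measurable (chi_norms :: ('n \<Rightarrow> real) measure) ?B"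
    by measurable
  have mg: "(\<lambda>q. g (q True) (q False)) \<in> borel_measurable ?B"
    using measurable_compose[OF _ g, of "\<lambda>q. (q True, q False)" ?B] by simp
  have "?B = distr chi_norms ?B (\<lambda>r. \<lambda>b\<in>UNIV. r (?f b))"
    by (rule distr_PiM_reindex[symmetric]) (use ij prob_space_chi in \<open>auto simp: inj_on_def split: if_splits\<close>)
  then have "(\<integral>\<^sup>+q. g (q True) (q False) \<partial>?B) = (\<integral>\<^sup>+q. g (q True) (q False) \<partial>distr chi_norms ?B (\<lambda>r. \<lambda>b\<in>UNIV. r (?f b)))"
    by simp
  also have "\<dots> = (\<integral>\<^sup>+r. g (r i) (r j) \<partial>chi_norms)"
    by (subst nn_integral_distr[OF m]) (simp_all add: mg)
  finally show ?thesis by simp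
qed

lemma nn_integral_chi_norms_component:
  fixes g :: "real \<Rightarrow> ennreal" and i :: "'n::finite"
  assumes g: "g \<in> borel_measurable borel"
  shows "(\<integral>\<^sup>+r. g (r i) \<partial>chi_norms) = (\<integral>\<^sup>+r. g r \<partial>chi_measure CARD('n))"
proof -
  have "distr chi_norms (chi_measure CARD('n)) (\<lambda>r. r i) = chi_measure CARD('n)"
    by (rule distr_PiM_component) (simp_all add: prob_space_chi)
  then have "(\<integral>\<^sup>+r. g r \<partial>chi_measure CARD('n)) = (\<integral>\<^sup>+r. g r \<partial>distr chi_norms (chi_measure CARD('n)) (\<lambda>r. r i))"
    by simp
  also have "\<dots> = (\<integral>\<^sup>+r. g (r i) \<partial>chi_norms)"
    by (rule nn_integral_distr) (use g in simp_all)
  finally show ?thesis by simp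
qed

lemma pair_moment_measurable [measurable]: "pair_moment CARD('n::finite) k \<in> borel_measurable borel"
proof -
  interpret prob_space "PiM (UNIV :: bool set) (\<lambda>_. chi_measure CARD('n))"
    by (intro prob_space_PiM prob_space_chi)
  show ?thesis
    unfolding pair_moment_def [abs_def] by measurable
qed

text \<open>The even exponent makes the power of the norm a polynomial in the squared norm, and for
  unit vectors the squared norm depends on the directions only through their inner product.\<close>

lemma coupled_pair_moment:
  fixes Q :: "(real^'n::finite^'n) measure"
  assumes Q: "prob_space Q" "sets Q = sets borel" and unit: "AE u in Q. \<forall>i. norm (u $ i) = 1" and ij: "i \<noteq> j"
  shows "(\<integral>\<^sup>+W. ennreal (norm (W $ i + W $ j) ^ (2 * k)) \<partial>coupled_measure Q)
    = (\<integral>\<^sup>+u. pair_moment CARD('n) k (u $ i \<bullet> u $ j) \<partial>Q)"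
proof -
  have m: "(\<lambda>W :: real^'n^'n. ennreal (norm (W $ i + W $ j) ^ (2 * k))) \<in> borel_measurable borel"
    by (intro measurable_compose[OF _ measurable_ennreal] borel_measurable_continuous_onI continuous_intros)
  show ?thesis
    unfolding nn_integral_coupled(1)[OF Q m]
  proof (rule nn_integral_cong_AE, use unit in eventually_elim)
    fix u :: "real^'n^'n" assume u: "\<forall>i. norm (u $ i) = 1"
    have "norm (a *\<^sub>R u $ i + b *\<^sub>R u $ j) ^ (2 * k) = (a\<^sup>2 + b\<^sup>2 + 2 * a * b * (u $ i \<bullet> u $ j)) ^ k" for a b
    proof -
      have "u $ i \<bullet> u $ i = 1" "u $ j \<bullet> u $ j = 1"
        using u by (auto simp flip: power2_norm_eq_inner)
      then have "(norm (a *\<^sub>R u $ i + b *\<^sub>R u $ j))\<^sup>2 = a\<^sup>2 + b\<^sup>2 + 2 * a * b * (u $ i \<bullet> u $ j)"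
        unfolding power2_norm_eq_inner
        by (simp add: inner_add_left inner_add_right inner_commute power2_eq_square algebra_simps)
      then show ?thesis by (simp add: power_mult)
    qed
    then show "(\<integral>\<^sup>+r. ennreal (norm ((\<chi> i. r i *\<^sub>R u $ i) $ i + (\<chi> i. r i *\<^sub>R u $ i) $ j) ^ (2 * k)) \<partial>chi_norms)
        = pair_moment CARD('n) k (u $ i \<bullet> u $ j)"
      unfolding pair_moment_def
      using nn_integral_chi_norms_pair[OF ij, of "\<lambda>a b. ennreal ((a\<^sup>2 + b\<^sup>2 + 2 * a * b * (u $ i \<bullet> u $ j)) ^ k)"]
      by simp
  qed
qed

text \<open>Jensen's inequality for \<open>x ^ k\<close> with equal weights, preceded by
  monotonicity because \<open>c\<close> is only a lower bound for the mean.\<close>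

lemma power_sum_ge:
  fixes y :: "'a \<Rightarrow> real"
  assumes "finite A" "A \<noteq> {}" "\<And>p. p \<in> A \<Longrightarrow> 0 \<le> y p" "0 \<le> c" "real (card A) * c \<le> (\<Sum>p\<in>A. y p)"
  shows "real (card A) * c ^ k \<le> (\<Sum>p\<in>A. y p ^ k)"
proof -
  have N: "real (card A) > 0" using assms by (simp add: card_gt_0_iff)
  \<comment> \<open>Odd powers are convex only on the nonnegative half-line, even powers everywhere;
    hence the case split.\<close>
  have convex: "convex_on {0::real..} (\<lambda>x. x ^ k)"
    by (cases "even k") (auto intro: convex_power_odd convex_on_subset[OF convex_power_even])
  have "c \<le> (\<Sum>p\<in>A. (1 / real (card A)) *\<^sub>R y p)"
    using assms(5) N by (simp add: field_simps flip: sum_divide_distrib)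
  then have "c ^ k \<le> (\<Sum>p\<in>A. (1 / real (card A)) *\<^sub>R y p) ^ k"
    by (rule power_mono) (use assms in simp)
  also have "\<dots> \<le> (\<Sum>p\<in>A. (1 / real (card A)) * y p ^ k)"
    by (rule convex_on_sum[OF _ _ convex]) (use assms N in auto)
  finally show ?thesis
    using N by (simp add: field_simps flip: sum_divide_distrib)
qed

text \<open>The inequality already holds for fixed norms. The squared length is affine in the inner
  product with slope \<open>2 * q True * q False\<close>, nonnegative almost surely, so the lower
  bound on the mean of \<open>t\<close> passes to the squared lengths and
  \<open>power_sum_ge\<close> applies.\<close>

lemma pair_moment_sum_ge:
  fixes t :: "'a \<Rightarrow> real"
  assumes A: "finite A" "A \<noteq> {}" and t: "\<And>p. p \<in> A \<Longrightarrow> \<bar>t p\<bar> \<le> 1" and t0: "\<bar>t0\<bar> \<le> 1"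
    and mean: "real (card A) * t0 \<le> (\<Sum>p\<in>A. t p)"
  shows "of_nat (card A) * pair_moment CARD('n::finite) k t0 \<le> (\<Sum>p\<in>A. pair_moment CARD('n) k (t p))"
proof -
  let ?B = "PiM (UNIV :: bool set) (\<lambda>_. chi_measure CARD('n))"
  let ?y = "\<lambda>(q :: bool \<Rightarrow> real) s. (q True)\<^sup>2 + (q False)\<^sup>2 + 2 * q True * q False * s"
  have nonneg: "AE q in ?B. 0 \<le> q b" for b
    by (rule AE_PiM_component[where P = "\<lambda>r. 0 \<le> r"]) (simp_all add: prob_space_chi AE_chi_nonneg)
  have "of_nat (card A) * pair_moment CARD('n) k t0 = (\<integral>\<^sup>+q. of_nat (card A) * ennreal (?y q t0 ^ k) \<partial>?B)"
    unfolding pair_moment_def by (rule nn_integral_cmult[symmetric]) measurable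
  also have "\<dots> \<le> (\<integral>\<^sup>+q. (\<Sum>p\<in>A. ennreal (?y q (t p) ^ k)) \<partial>?B)"
  proof (rule nn_integral_mono_AE, use nonneg[of True] nonneg[of False] in eventually_elim)
    fix q :: "bool \<Rightarrow> real" assume q: "0 \<le> q True" "0 \<le> q False"
    have y: "0 \<le> ?y q s" if "\<bar>s\<bar> \<le> 1" for s
    proof -
      \<comment> \<open>Since \<open>s\<close> is at least -1, the squared length is at least
        \<open>(q True - q False)\<^sup>2\<close>.\<close>
      have "q True * q False * (- s) \<le> q True * q False * 1"
        by (rule mult_left_mono) (use that q in auto)
      moreover have "0 \<le> (q True - q False)\<^sup>2" by simp
      ultimately show ?thesis by (simp add: power2_diff)
    qed
    have "2 * q True * q False * (real (card A) * t0) \<le> 2 * q True * q False * (\<Sum>p\<in>A. t p)"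
      by (rule mult_left_mono[OF mean]) (use q in simp)
    moreover have "(\<Sum>p\<in>A. ?y q (t p)) = real (card A) * ((q True)\<^sup>2 + (q False)\<^sup>2) + 2 * q True * q False * (\<Sum>p\<in>A. t p)"
      by (simp add: sum.distrib distrib_left sum_distrib_left)
    ultimately have "real (card A) * ?y q t0 \<le> (\<Sum>p\<in>A. ?y q (t p))"
      by (simp add: algebra_simps)
    then have "real (card A) * ?y q t0 ^ k \<le> (\<Sum>p\<in>A. ?y q (t p) ^ k)"
      by (intro power_sum_ge A y t t0) auto
    then have "ennreal (real (card A) * ?y q t0 ^ k) \<le> ennreal (\<Sum>p\<in>A. ?y q (t p) ^ k)"
      by (rule ennreal_leI)
    then show "of_nat (card A) * ennreal (?y q t0 ^ k) \<le> (\<Sum>p\<in>A. ennreal (?y q (t p) ^ k))"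
      using y t t0 by (simp add: ennreal_mult sum_ennreal ennreal_of_nat_eq_real_of_nat)
  qed
  also have "\<dots> = (\<Sum>p\<in>A. pair_moment CARD('n) k (t p))"
    unfolding pair_moment_def by (rule nn_integral_sum) measurable
  finally show ?thesis .
qed

section \<open>Sums over ordered pairs of distinct indices\<close>

abbreviation off_diagonal :: "('n \<times> 'n) set" where
  "off_diagonal \<equiv> Sigma UNIV (\<lambda>i. UNIV - {i})"

lemma card_off_diagonal: "card (off_diagonal :: ('n::finite \<times> 'n) set) = CARD('n) * (CARD('n) - 1)"
  by (simp add: card_Diff_singleton)

text \<open>Expand the squared norm of the sum of all directions; the diagonal contributes
  \<open>CARD('n)\<close>.\<close>

lemma sum_inner_off_diagonal_ge:
  fixes u :: "real^'n::finite^'n"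
  assumes u: "\<And>i. norm (u $ i) = 1"
  shows "- real CARD('n) \<le> (\<Sum>p\<in>off_diagonal. u $ fst p \<bullet> u $ snd p)"
proof -
  have "0 \<le> (\<Sum>i\<in>UNIV. u $ i) \<bullet> (\<Sum>j\<in>UNIV. u $ j)" by simp
  also have "\<dots> = (\<Sum>i\<in>UNIV. \<Sum>j\<in>UNIV. u $ i \<bullet> u $ j)"
    by (simp add: inner_sum_left inner_sum_right) (rule sum.swap)
  also have "\<dots> = (\<Sum>i\<in>UNIV. u $ i \<bullet> u $ i + (\<Sum>j\<in>UNIV - {i}. u $ i \<bullet> u $ j))"
    by (intro sum.cong refl sum.remove) auto
  also have "\<dots> = real CARD('n) + (\<Sum>p\<in>off_diagonal. u $ fst p \<bullet> u $ snd p)"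
    using u by (simp add: sum.distrib sum.Sigma case_prod_unfold flip: power2_norm_eq_inner)
  finally show ?thesis by simp
qed

lemma coupled_pair_moments_ge:
  fixes Q :: "(real^'n::finite^'n) measure"
  assumes n: "CARD('n) \<ge> 2"
    and Q: "prob_space Q" "sets Q = sets borel" and unit: "AE u in Q. \<forall>i. norm (u $ i) = 1"
  shows "of_nat (card (off_diagonal :: ('n \<times> 'n) set)) * pair_moment CARD('n) k (- 1 / (real CARD('n) - 1))
    \<le> (\<Sum>p\<in>off_diagonal. \<integral>\<^sup>+W. ennreal (norm (W $ fst p + W $ snd p) ^ (2 * k)) \<partial>coupled_measure Q)"
proof -
  interpret Q: prob_space Q by fact
  let ?t0 = "- 1 / (real CARD('n) - 1)"
  let ?A = "off_diagonal :: ('n \<times> 'n) set"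
  have nonempty: "?A \<noteq> {}"
    using card_off_diagonal[where 'n = 'n] n by (metis card.empty mult_is_0 not_numeral_le_zero diff_is_0_eq numeral_le_one_iff semiring_norm(69) order_trans)
  \<comment> \<open>With d(d - 1) ordered pairs, \<open>?t0\<close> is exactly the smallest mean
    permitted by \<open>sum_inner_off_diagonal_ge\<close>.\<close>
  have c: "real (card ?A) * ?t0 = - real CARD('n)"
    unfolding card_off_diagonal using n by (simp add: of_nat_diff field_simps)
  have "of_nat (card ?A) * pair_moment CARD('n) k ?t0
      = (\<integral>\<^sup>+u. of_nat (card ?A) * pair_moment CARD('n) k ?t0 \<partial>Q)"
    by (simp add: Q.emeasure_space_1)
  also have "\<dots> \<le> (\<integral>\<^sup>+u. (\<Sum>p\<in>?A. pair_moment CARD('n) k (u $ fst p \<bullet> u $ snd p)) \<partial>Q)"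
  proof (rule nn_integral_mono_AE, use unit in eventually_elim)
    fix u :: "real^'n^'n" assume u: "\<forall>i. norm (u $ i) = 1"
    show "of_nat (card ?A) * pair_moment CARD('n) k ?t0 \<le> (\<Sum>p\<in>?A. pair_moment CARD('n) k (u $ fst p \<bullet> u $ snd p))"
    proof (rule pair_moment_sum_ge[OF _ nonempty])
      show "\<bar>u $ fst p \<bullet> u $ snd p\<bar> \<le> 1" for p
        using Cauchy_Schwarz_ineq2[of "u $ fst p" "u $ snd p"] u by simp
      show "\<bar>?t0\<bar> \<le> 1" using n by (simp add: field_simps)
      show "real (card ?A) * ?t0 \<le> (\<Sum>p\<in>?A. u $ fst p \<bullet> u $ snd p)"
        unfolding c by (rule sum_inner_off_diagonal_ge) (use u in simp)
    qed simp
  qed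
  also have "\<dots> = (\<Sum>p\<in>?A. \<integral>\<^sup>+u. pair_moment CARD('n) k (u $ fst p \<bullet> u $ snd p) \<partial>Q)"
  proof (rule nn_integral_sum)
    fix p :: "'n \<times> 'n"
    have "(\<lambda>u :: real^'n^'n. u $ fst p \<bullet> u $ snd p) \<in> borel_measurable borel"
      by (intro borel_measurable_continuous_onI continuous_intros)
    then show "(\<lambda>u. pair_moment CARD('n) k (u $ fst p \<bullet> u $ snd p)) \<in> borel_measurable Q"
      unfolding measurable_cong_sets[OF Q(2) refl]
      by (rule measurable_compose[OF _ pair_moment_measurable])
  qed
  also have "\<dots> = (\<Sum>p\<in>?A. \<integral>\<^sup>+W. ennreal (norm (W $ fst p + W $ snd p) ^ (2 * k)) \<partial>coupled_measure Q)"
    by (intro sum.cong refl coupled_pair_moment[OF Q unit, symmetric]) auto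
  finally show ?thesis .
qed

section \<open>The simplex coupling\<close>

lemma ones_but_last_inner_axis:
  "axis i 1 \<bullet> (ones_but_last :: real^'n::{finite,linorder}) = (if i = Max UNIV then 0 else 1)"
  by (simp add: ones_but_last_def inner_axis')

lemma ones_but_last_inner_self:
  "(ones_but_last :: real^'n::{finite,linorder}) \<bullet> ones_but_last = real CARD('n) - 1"
proof -
  have "(ones_but_last :: real^'n::_) \<bullet> ones_but_last = (\<Sum>k\<in>UNIV. if k = Max (UNIV :: 'n set) then 0 else 1)"
    by (auto simp: ones_but_last_def inner_vec_def intro!: sum.cong)
  also have "\<dots> = real (card (UNIV - {Max (UNIV :: 'n set)}))"
    by (simp add: sum.If_cases Compl_eq_Diff_UNIV)
  also have "\<dots> = real CARD('n) - 1"
    by (simp add: card_Diff_singleton of_nat_diff Suc_leI)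
  finally show ?thesis .
qed

text \<open>With s and m the square roots of d and d - 1, every entry of the Gram matrix is a
  rational function of s and m, and all values follow from s * s = m * m + 1.\<close>

lemma simplex_S_inner:
  assumes n: "CARD('n::{finite,linorder}) \<ge> 2"
  shows "(simplex_S :: real^'n::{finite,linorder}^'n::{finite,linorder}) $ i \<bullet> simplex_S $ j = (if i = j then 1 else - 1 / (real CARD('n) - 1))"
proof -
  define s where "s = sqrt (real CARD('n))"
  define m where "m = sqrt (real CARD('n) - 1)"
  have s2: "s * s = real CARD('n)" and m2: "m * m = s * s - 1" and m: "m > 0"
    using n by (simp_all add: s_def m_def)
  have pw: "(real CARD('n) - 1) powr (3 / 2) = m * m * m"
  proof -
    have "(real CARD('n) - 1) powr (3 / 2) = (real CARD('n) - 1) powr (1 + 1 / 2)" by simp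
    also have "\<dots> = (real CARD('n) - 1) * m"
      using n by (simp only: powr_add m_def) (simp add: powr_half_sqrt)
    finally show ?thesis using m2 s2 by simp
  qed
  have S: "(simplex_S :: real^'n::_^'n::_) $ i = (if i = Max UNIV then (1 / m) *\<^sub>R ones_but_last
      else (s / m) *\<^sub>R axis i 1 - ((s + 1) / (m * m * m)) *\<^sub>R ones_but_last)" for i
    unfolding simplex_S_def pw s_def[symmetric] by (simp add: m_def s_def real_sqrt_divide)
  have ax: "axis i (1::real) \<bullet> axis j 1 = (if i = j then 1 else 0)" for i j :: 'n
    by (simp add: inner_axis_axis)
  have oo: "(ones_but_last :: real^'n::_) \<bullet> ones_but_last = m * m"
    using ones_but_last_inner_self[where 'n = 'n] m2 s2 by simp
  have oa: "(ones_but_last :: real^'n::_) \<bullet> axis i 1 = (if i = Max UNIV then 0 else 1)" for i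
    using ones_but_last_inner_axis[of i] by (simp add: inner_commute)
  have nm: "real CARD('n) - 1 = m * m" using m2 s2 by simp
  have ss: "s * s = m * m + 1" using m2 by simp
  \<comment> \<open>The four identities are the four kinds of row products: a row other than the
    last with itself (\<open>e1\<close>), two distinct such rows (\<open>e2\<close>), the last row
    with another (\<open>e3\<close>), the last row with itself (\<open>e4\<close>).\<close>
  have e1: "s / m * (s / m) - 2 * (s / m * ((s + 1) / (m * m * m))) + (s + 1) / (m * m * m) * ((s + 1) / (m * m * m)) * (m * m) = 1"
  proof -
    have "s / m * (s / m) - 2 * (s / m * ((s + 1) / (m * m * m))) + (s + 1) / (m * m * m) * ((s + 1) / (m * m * m)) * (m * m)
        = (s * s * (m * m) - 2 * (s * (s + 1)) + (s + 1) * (s + 1)) / (m * m * m * m)"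
      using m by (simp add: field_simps)
    also have "s * s * (m * m) - 2 * (s * (s + 1)) + (s + 1) * (s + 1) = m * m * m * m"
      using ss by algebra
    finally show ?thesis using m by simp
  qed
  have e2: "- 2 * (s / m * ((s + 1) / (m * m * m))) + (s + 1) / (m * m * m) * ((s + 1) / (m * m * m)) * (m * m) = - 1 / (m * m)"
  proof -
    have "- 2 * (s / m * ((s + 1) / (m * m * m))) + (s + 1) / (m * m * m) * ((s + 1) / (m * m * m)) * (m * m)
        = (- 2 * (s * (s + 1)) + (s + 1) * (s + 1)) / (m * m * m * m)"
      using m by (simp add: field_simps)
    also have "- 2 * (s * (s + 1)) + (s + 1) * (s + 1) = - (m * m)"
      using ss by algebra
    finally show ?thesis using m by simp
  qed
  have e3: "1 / m * (s / m) - 1 / m * ((s + 1) / (m * m * m)) * (m * m) = - 1 / (m * m)"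
    using m by (simp add: field_simps)
  have e4: "1 / m * (1 / m) * (m * m) = 1" using m by simp
  \<comment> \<open>Opaque names for the coefficients keep the simplifier from rearranging the
    fractions, so that the four identities match.\<close>
  define a b c t where "a = s / m" and "b = (s + 1) / (m * m * m)" and "c = 1 / m" and "t = - 1 / (m * m)"
  note abct = a_def[symmetric] b_def[symmetric] c_def[symmetric] t_def[symmetric]
  show ?thesis
    unfolding S nm abct
    by (cases "i = Max UNIV"; cases "j = Max UNIV"; cases "i = j")
       (use e1[unfolded abct] e2[unfolded abct] e3[unfolded abct] e4[unfolded abct] in
        \<open>simp_all add: inner_diff_left inner_diff_right ones_but_last_inner_axis oo oa ax algebra_simps\<close>)
qed

section \<open>The law of the Haar-rotated simplex\<close>

lemma matrix_mult_row:
  fixes A B :: "real^'n^'n"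
  shows "(A ** B) $ i = transpose B *v (A $ i)"
  by (simp add: vec_eq_iff matrix_matrix_mult_def matrix_vector_mult_def transpose_def mult.commute
      del: transpose_matrix_vector)

lemma measure_eqI_nn_integral_borel:
  assumes M: "sets M = sets (borel :: 'a::topological_space measure)" and N: "sets N = sets borel"
    and eq: "\<And>f. f \<in> borel_measurable borel \<Longrightarrow> (\<integral>\<^sup>+x. f x \<partial>M) = (\<integral>\<^sup>+x. f x \<partial>N)"
  shows "M = N"
proof (rule measure_eqI)
  fix A assume "A \<in> sets M"
  then show "emeasure M A = emeasure N A"
    using eq[of "indicator A"] M N by simp
qed (simp add: M N)

lemma distr_eqI_nn_integral_borel:
  fixes X :: "'a \<Rightarrow> 'b::topological_space"
  assumes X: "X \<in> borel_measurable M" and N: "sets N = sets borel"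
    and eq: "\<And>f. f \<in> borel_measurable borel \<Longrightarrow> (\<integral>\<^sup>+x. f (X x) \<partial>M) = (\<integral>\<^sup>+x. f x \<partial>N)"
  shows "distr M borel X = N"
  by (rule measure_eqI_nn_integral_borel) (simp_all add: N nn_integral_distr[OF X] eq)

definition simplex_directions :: "(real^'n::{finite,linorder}^'n::{finite,linorder}) measure \<Rightarrow> (real^'n::{finite,linorder}^'n::{finite,linorder}) measure" where
  "simplex_directions H = distr H borel (\<lambda>R. simplex_S ** R)"

context
  fixes H :: "(real^'n::{finite,linorder}^'n::{finite,linorder}) measure"
  assumes n: "CARD('n) \<ge> 2" and H: "haar_orthogonal H"
begin

lemma sets_haar: "sets H = sets borel"
  using H by (simp add: haar_orthogonal_def)

lemma measurable_simplex_mult: "(\<lambda>R. simplex_S ** R) \<in> borel_measurable H"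
  unfolding measurable_cong_sets[OF sets_haar refl]
  by (intro borel_measurable_continuous_onI continuous_intros)

lemma prob_space_simplex_directions: "prob_space (simplex_directions H)"
proof -
  interpret prob_space H using H by (simp add: haar_orthogonal_def)
  show ?thesis
    unfolding simplex_directions_def by (rule prob_space_distr) (rule measurable_simplex_mult)
qed

lemma sets_simplex_directions: "sets (simplex_directions H) = sets borel"
  by (simp add: simplex_directions_def)

text \<open>The rows of \<open>simplex_S ** R\<close> are the simplex rows rotated by
  \<open>transpose R\<close>, which preserves the Gram matrix.\<close>

lemma AE_simplex_directions:
  "AE u in simplex_directions H. u $ i \<bullet> u $ j = (if i = j then 1 else - 1 / (real CARD('n) - 1))"
proof -
  have eq: "(simplex_S ** R) $ i \<bullet> (simplex_S ** R) $ j = (if i = j then 1 else - 1 / (real CARD('n) - 1))"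
    if R: "orthogonal_matrix R" for R :: "real^'n::_^'n::_"
  proof -
    have "orthogonal_transformation (\<lambda>x. transpose R *v x)"
      using R by (simp add: orthogonal_transformation_matrix orthogonal_matrix_transpose del: transpose_matrix_vector)
    then have "(transpose R *v simplex_S $ i) \<bullet> (transpose R *v simplex_S $ j) = simplex_S $ i \<bullet> (simplex_S :: real^'n::_^'n::_) $ j"
      unfolding orthogonal_transformation_def by blast
    then show ?thesis by (simp only: matrix_mult_row simplex_S_inner[OF n])
  qed
  have "(\<lambda>u :: real^'n::_^'n::_. u $ i \<bullet> u $ j) \<in> borel_measurable borel"
    by (intro borel_measurable_continuous_onI continuous_intros)
  then have m: "{u \<in> space borel. u $ i \<bullet> u $ j = (if i = j then 1 else - 1 / (real CARD('n) - 1))} \<in> sets (borel :: (real^'n::_^'n::_) measure)"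
    by measurable
  show ?thesis
    unfolding simplex_directions_def AE_distr_iff[OF measurable_simplex_mult m]
  proof (rule eventually_mono)
    show "AE R in H. orthogonal_matrix R" using H by (simp add: haar_orthogonal_def)
  qed (rule eq)
qed

lemma AE_simplex_directions_unit: "AE u in simplex_directions H. \<forall>i. norm (u $ i) = 1"
  unfolding AE_all_countable
proof
  fix i
  show "AE u in simplex_directions H. norm (u $ i) = 1"
    using AE_simplex_directions[of i i] by eventually_elim (simp add: norm_eq_1)
qed

lemma simrf_eq: "simrf H = coupled_measure (simplex_directions H)"
  by (simp add: simrf_def simplex_directions_def)

text \<open>For fixed norms the whole tuple is one fixed configuration of vectors moved by a common
  rotation, which is the form in which Haar invariance applies.\<close>

lemma nn_integral_simrf:
  fixes f :: "real^'n::_^'n::_ \<Rightarrow> ennreal"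
  assumes f: "f \<in> borel_measurable borel"
  shows "(\<integral>\<^sup>+W. f W \<partial>simrf H) = (\<integral>\<^sup>+r. (\<integral>\<^sup>+R. f (\<chi> i. transpose R *v (r i *\<^sub>R simplex_S $ i)) \<partial>H) \<partial>chi_norms)"
  unfolding simrf_eq nn_integral_coupled(2)[OF prob_space_simplex_directions sets_simplex_directions f]
proof (rule nn_integral_cong)
  fix r :: "'n \<Rightarrow> real"
  have "(\<lambda>u. f (\<chi> i. r i *\<^sub>R u $ i)) \<in> borel_measurable borel"
    by (rule measurable_compose[OF _ f]) (intro borel_measurable_continuous_onI continuous_intros)
  then have "(\<integral>\<^sup>+u. f (\<chi> i. r i *\<^sub>R u $ i) \<partial>simplex_directions H) = (\<integral>\<^sup>+R. f (\<chi> i. r i *\<^sub>R (simplex_S ** R) $ i) \<partial>H)"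
    unfolding simplex_directions_def by (subst nn_integral_distr[OF measurable_simplex_mult]) simp_all
  then show "(\<integral>\<^sup>+u. f (\<chi> i. r i *\<^sub>R u $ i) \<partial>simplex_directions H) = (\<integral>\<^sup>+R. f (\<chi> i. transpose R *v (r i *\<^sub>R simplex_S $ i)) \<partial>H)"
    by (simp only: matrix_mult_row matrix_vector_mult_scaleR)
qed

text \<open>One row is a chi-distributed norm times an independent Haar-rotated unit vector, so the
  polar decomposition \<open>chi_times_haar_direction\<close> identifies its law.\<close>

lemma simrf_marginal: "distr (simrf H) borel (\<lambda>W. W $ i) = std_gauss"
proof (rule distr_eqI_nn_integral_borel)
  have m: "(\<lambda>W :: real^'n::_^'n::_. W $ i) \<in> borel_measurable borel"
    by (intro borel_measurable_continuous_onI continuous_intros)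
  then show "(\<lambda>W. W $ i) \<in> borel_measurable (simrf H)"
    by (simp add: simrf_eq cong: measurable_cong_sets)
  fix f :: "real^'n::_ \<Rightarrow> ennreal" assume f: "f \<in> borel_measurable borel"
  interpret H: prob_space H using H by (simp add: haar_orthogonal_def)
  have s: "norm ((simplex_S :: real^'n::_^'n::_) $ i) = 1"
    using simplex_S_inner[OF n, of i i] by (simp add: norm_eq_1)
  have m2: "(\<lambda>p :: real \<times> (real^'n::_^'n::_). f (fst p *\<^sub>R (transpose (snd p) *v simplex_S $ i))) \<in> borel_measurable borel"
    by (rule measurable_compose[OF _ f]) (intro borel_measurable_continuous_onI continuous_intros)
  have "(\<lambda>(r, R). f (r *\<^sub>R (transpose R *v simplex_S $ i))) \<in> borel_measurable (borel \<Otimes>\<^sub>M H)"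
    unfolding case_prod_unfold measurable_pair_borel[OF refl sets_haar] by (rule m2)
  note m3 = H.borel_measurable_nn_integral[OF this]
  have "(\<integral>\<^sup>+W. f (W $ i) \<partial>simrf H) = (\<integral>\<^sup>+r. (\<integral>\<^sup>+R. f (r i *\<^sub>R (transpose R *v simplex_S $ i)) \<partial>H) \<partial>chi_norms)"
    unfolding nn_integral_simrf[OF measurable_compose[OF m f]]
    by (simp add: matrix_vector_mult_scaleR del: transpose_matrix_vector)
  also have "\<dots> = (\<integral>\<^sup>+r. (\<integral>\<^sup>+R. f (r *\<^sub>R (transpose R *v simplex_S $ i)) \<partial>H) \<partial>chi_measure CARD('n))"
    by (rule nn_integral_chi_norms_component[OF m3])
  also have "\<dots> = (\<integral>\<^sup>+w. f w \<partial>std_gauss)"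
    by (rule chi_times_haar_direction[OF H s f])
  finally show "(\<integral>\<^sup>+W. f (W $ i) \<partial>simrf H) = (\<integral>\<^sup>+w. f w \<partial>std_gauss)" .
qed simp

text \<open>The product of \<open>U\<close> and \<open>transpose R\<close> is the transpose of
  \<open>R ** transpose U\<close>, so right invariance absorbs the extra rotation for each fixed
  choice of norms.\<close>

lemma simrf_pair_rotation:
  assumes U: "orthogonal_matrix U"
  shows "distr (simrf H) borel (\<lambda>W. U *v (W $ i + W $ j)) = distr (simrf H) borel (\<lambda>W. W $ i + W $ j)"
proof (rule distr_eqI_nn_integral_borel)
  have m0: "(\<lambda>W :: real^'n::_^'n::_. W $ i + W $ j) \<in> borel_measurable borel"
    and m1: "(\<lambda>W :: real^'n::_^'n::_. U *v (W $ i + W $ j)) \<in> borel_measurable borel"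
    by (intro borel_measurable_continuous_onI continuous_intros)+
  have m0': "(\<lambda>W. W $ i + W $ j) \<in> borel_measurable (simrf H)"
    using m0 by (simp add: simrf_eq cong: measurable_cong_sets)
  show "(\<lambda>W. U *v (W $ i + W $ j)) \<in> borel_measurable (simrf H)"
    using m1 by (simp add: simrf_eq cong: measurable_cong_sets)
  fix f :: "real^'n::_ \<Rightarrow> ennreal" assume f: "f \<in> borel_measurable borel"
  have "(\<integral>\<^sup>+R. f (U *v (transpose R *v a)) \<partial>H) = (\<integral>\<^sup>+R. f (transpose R *v a) \<partial>H)" for a
  proof -
    have "(\<lambda>R. f (transpose R *v a)) \<in> borel_measurable borel"
      by (rule measurable_compose[OF _ f]) (intro borel_measurable_continuous_onI continuous_intros)
    from haar_right_invariant[OF H _ this, of "transpose U"] U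
    show ?thesis
      by (simp add: orthogonal_matrix_transpose matrix_transpose_mul matrix_vector_mul_assoc del: transpose_matrix_vector)
  qed
  then have "(\<integral>\<^sup>+W. f (U *v (W $ i + W $ j)) \<partial>simrf H) = (\<integral>\<^sup>+W. f (W $ i + W $ j) \<partial>simrf H)"
    unfolding nn_integral_simrf[OF measurable_compose[OF m1 f]] nn_integral_simrf[OF measurable_compose[OF m0 f]]
    by (simp flip: matrix_vector_right_distrib del: transpose_matrix_vector)
  then show "(\<integral>\<^sup>+W. f (U *v (W $ i + W $ j)) \<partial>simrf H) = (\<integral>\<^sup>+w. f w \<partial>distr (simrf H) borel (\<lambda>W. W $ i + W $ j))"
    by (subst nn_integral_distr[OF m0']) (simp_all add: f)
qed simp

lemma wig_coupling_simrf: "wig_coupling (simrf H)"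
  unfolding wig_coupling_def
  using simrf_marginal simrf_pair_rotation simrf_eq prob_space_simplex_directions
    sets_simplex_directions AE_simplex_directions_unit by blast

text \<open>For the simplex all off-diagonal inner products are almost surely the extremal constant,
  so the general lower bound is attained.\<close>

lemma simrf_pair_moments_le:
  assumes P: "wig_coupling P"
  shows "(\<Sum>p\<in>off_diagonal. \<integral>\<^sup>+W. ennreal (norm (W $ fst p + W $ snd p) ^ (2 * k)) \<partial>simrf H)
    \<le> (\<Sum>p\<in>off_diagonal. \<integral>\<^sup>+W. ennreal (norm (W $ fst p + W $ snd p) ^ (2 * k)) \<partial>(P :: (real^'n::_^'n::_) measure))"
proof -
  let ?t0 = "- 1 / (real CARD('n) - 1)"
  let ?A = "off_diagonal :: ('n \<times> 'n) set"
  interpret D: prob_space "simplex_directions H" by (rule prob_space_simplex_directions)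
  obtain Q where Q: "prob_space Q" "sets Q = sets borel" "AE u in Q. \<forall>i. norm (u $ i) = 1" "P = coupled_measure Q"
    using P by (auto simp: wig_coupling_def)
  have "(\<integral>\<^sup>+W. ennreal (norm (W $ fst p + W $ snd p) ^ (2 * k)) \<partial>simrf H) = pair_moment CARD('n) k ?t0" if "p \<in> ?A" for p
  proof -
    have ne: "fst p \<noteq> snd p" using that by auto
    have "(\<integral>\<^sup>+W. ennreal (norm (W $ fst p + W $ snd p) ^ (2 * k)) \<partial>simrf H)
        = (\<integral>\<^sup>+u. pair_moment CARD('n) k (u $ fst p \<bullet> u $ snd p) \<partial>simplex_directions H)"
      unfolding simrf_eq
      by (rule coupled_pair_moment[OF prob_space_simplex_directions sets_simplex_directions AE_simplex_directions_unit ne])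
    also have "\<dots> = (\<integral>\<^sup>+u. pair_moment CARD('n) k ?t0 \<partial>simplex_directions H)"
      by (rule nn_integral_cong_AE, use AE_simplex_directions[of "fst p" "snd p"] in eventually_elim) (simp add: ne)
    finally show ?thesis by (simp add: D.emeasure_space_1)
  qed
  then have "(\<Sum>p\<in>?A. \<integral>\<^sup>+W. ennreal (norm (W $ fst p + W $ snd p) ^ (2 * k)) \<partial>simrf H)
      = of_nat (card ?A) * pair_moment CARD('n) k ?t0"
    by simp
  also have "\<dots> \<le> (\<Sum>p\<in>?A. \<integral>\<^sup>+W. ennreal (norm (W $ fst p + W $ snd p) ^ (2 * k)) \<partial>P)"
    unfolding Q(4) by (rule coupled_pair_moments_ge[OF n Q(1-3)])
  finally show ?thesis .
qed

text \<open>The coefficients are arbitrary so that both the conformity and the squared error are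
  covered. The sum over pairs has to be moved inside the series because the moments are compared
  only after summing over all pairs.\<close>

lemma simrf_pair_series_le:
  fixes c :: "nat \<Rightarrow> ennreal"
  assumes P: "wig_coupling P"
  shows "(\<Sum>p\<in>off_diagonal. \<Sum>k. c k * (\<integral>\<^sup>+W. ennreal (norm (W $ fst p + W $ snd p) ^ (2 * k)) \<partial>simrf H))
    \<le> (\<Sum>p\<in>off_diagonal. \<Sum>k. c k * (\<integral>\<^sup>+W. ennreal (norm (W $ fst p + W $ snd p) ^ (2 * k)) \<partial>(P :: (real^'n::_^'n::_) measure)))"
proof -
  have swap: "(\<Sum>p\<in>(off_diagonal :: ('n \<times> 'n) set). \<Sum>k. c k * (\<integral>\<^sup>+W. ennreal (norm (W $ fst p + W $ snd p) ^ (2 * k)) \<partial>M))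
      = (\<Sum>k. c k * (\<Sum>p\<in>off_diagonal. \<integral>\<^sup>+W. ennreal (norm (W $ fst p + W $ snd p) ^ (2 * k)) \<partial>M))"
    for M :: "(real^'n::_^'n::_) measure"
    by (simp add: sum_distrib_left suminf_sum)
  show ?thesis
    unfolding swap by (intro suminf_le mult_left_mono simrf_pair_moments_le P) auto
qed

end

section \<open>Mean squared error and conformity\<close>

lemma wig_coupling_props:
  assumes "wig_coupling (P :: (real^'n::finite^'n) measure)"
  shows "prob_space P" "sets P = sets borel"
  using assms prob_space_coupled by (auto simp: wig_coupling_def)

text \<open>Averaging over a Haar matrix replaces the exponential by an even power series in
  \<open>norm w\<close> with nonnegative coefficients; their actual values are irrelevant.\<close>

lemma rotation_invariant_mgf:
  fixes M :: "(real^'n::finite) measure" and e :: "real^'n"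
  assumes H: "haar_orthogonal H" and M: "prob_space M" and sM: "sets M = sets borel" and e: "norm e = 1"
    and inv: "\<And>U. orthogonal_matrix U \<Longrightarrow> distr M borel (\<lambda>w. U *v w) = M"
  shows "(\<integral>\<^sup>+w. ennreal (exp (w \<bullet> z)) \<partial>M)
    = (\<Sum>k. (\<integral>\<^sup>+R. ennreal (((R *v e) \<bullet> z) ^ (2 * k) / fact (2 * k)) \<partial>H) * (\<integral>\<^sup>+w. ennreal (norm w ^ (2 * k)) \<partial>M))"
proof -
  interpret H: prob_space H using H by (simp add: haar_orthogonal_def)
  interpret M: prob_space M by (rule M)
  interpret pair_sigma_finite M H by unfold_locales
  have sH: "sets H = sets borel" using H by (simp add: haar_orthogonal_def)
  note mM = measurable_cong_sets[OF sM refl] and mH = measurable_cong_sets[OF sH refl]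
  define c where "c k = (\<integral>\<^sup>+R. ennreal (((R *v e) \<bullet> z) ^ (2 * k) / fact (2 * k)) \<partial>H)" for k
  have mexp: "(\<lambda>w :: real^'n. ennreal (exp (s * (w \<bullet> z)))) \<in> borel_measurable borel" for s
    by (intro measurable_compose[OF _ measurable_ennreal] borel_measurable_continuous_onI continuous_intros)
  have me: "(\<lambda>w :: real^'n. ennreal (exp (w \<bullet> z))) \<in> borel_measurable borel"
    using mexp[of 1] by simp
  have average: "(\<integral>\<^sup>+R. ennreal (exp ((R *v w) \<bullet> z)) \<partial>H) = (\<Sum>k. ennreal (norm w ^ (2 * k)) * c k)" for w
  proof -
    let ?I = "\<lambda>s. \<integral>\<^sup>+R. ennreal (exp (s * ((R *v e) \<bullet> z))) \<partial>H"
    have mI: "(\<lambda>R. ennreal (exp (s * ((R *v e) \<bullet> z)))) \<in> borel_measurable H" for s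
      unfolding mH
      by (intro measurable_compose[OF _ measurable_ennreal] borel_measurable_continuous_onI continuous_intros)
    have I: "(\<integral>\<^sup>+R. ennreal (exp ((R *v w) \<bullet> z)) \<partial>H) = ?I s" if "\<bar>s\<bar> = norm w" for s
    proof -
      have "(\<integral>\<^sup>+R. ennreal (exp ((R *v w) \<bullet> z)) \<partial>H) = (\<integral>\<^sup>+R. ennreal (exp ((R *v (s *\<^sub>R e)) \<bullet> z)) \<partial>H)"
        by (rule haar_orbit[OF H _ me]) (simp add: e that)
      then show ?thesis by (simp add: matrix_vector_mult_scaleR)
    qed
    have "2 * (\<integral>\<^sup>+R. ennreal (exp ((R *v w) \<bullet> z)) \<partial>H) = ?I (norm w) + ?I (- norm w)"
      using I[of "norm w"] I[of "- norm w"] by (simp add: mult_2)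
    also have "\<dots> = (\<integral>\<^sup>+R. ennreal (exp (norm w * ((R *v e) \<bullet> z))) + ennreal (exp (- norm w * ((R *v e) \<bullet> z))) \<partial>H)"
      by (rule nn_integral_add[symmetric]) (rule mI)+
    also have "\<dots> = (\<integral>\<^sup>+R. (\<Sum>k. 2 * (ennreal (norm w ^ (2 * k)) * ennreal (((R *v e) \<bullet> z) ^ (2 * k) / fact (2 * k)))) \<partial>H)"
    proof (rule nn_integral_cong)
      fix R :: "real^'n^'n"
      define y where "y = (R *v e) \<bullet> z"
      \<comment> \<open>The odd terms of the cosh series vanish, so it can be reindexed along the
        even numbers.\<close>
      have "(\<lambda>k. (norm w * y) ^ (2 * k) /\<^sub>R fact (2 * k)) sums cosh (norm w * y)"
        using cosh_converges[of "norm w * y"]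
        by (subst (asm) sums_mono_reindex[of "\<lambda>k. 2 * k", symmetric]) (auto simp: strict_mono_def elim!: evenE)
      then have "(\<lambda>k. norm w ^ (2 * k) * (y ^ (2 * k) / fact (2 * k))) sums cosh (norm w * y)"
        by (simp add: power_mult_distrib divide_inverse mult_ac)
      then have "(\<Sum>k. ennreal (norm w ^ (2 * k) * (y ^ (2 * k) / fact (2 * k)))) = ennreal (cosh (norm w * y))"
        by (intro suminf_ennreal_eq) auto
      then have "(\<Sum>k. ennreal (norm w ^ (2 * k)) * ennreal (y ^ (2 * k) / fact (2 * k))) = ennreal (cosh (norm w * y))"
        by (simp flip: ennreal_mult)
      moreover have "ennreal (exp (norm w * y)) + ennreal (exp (- norm w * y)) = 2 * ennreal (cosh (norm w * y))"
      proof -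
        have "ennreal (exp (norm w * y)) + ennreal (exp (- norm w * y)) = ennreal (2 * cosh (norm w * y))"
          by (simp add: cosh_def flip: ennreal_plus)
        then show ?thesis by (simp add: ennreal_mult)
      qed
      ultimately show "ennreal (exp (norm w * ((R *v e) \<bullet> z))) + ennreal (exp (- norm w * ((R *v e) \<bullet> z)))
          = (\<Sum>k. 2 * (ennreal (norm w ^ (2 * k)) * ennreal (((R *v e) \<bullet> z) ^ (2 * k) / fact (2 * k))))"
        by (simp only: ennreal_suminf_cmult y_def)
    qed
    also have "\<dots> = (\<Sum>k. \<integral>\<^sup>+R. 2 * (ennreal (norm w ^ (2 * k)) * ennreal (((R *v e) \<bullet> z) ^ (2 * k) / fact (2 * k))) \<partial>H)"
    proof (rule nn_integral_suminf)
      fix k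
      have "(\<lambda>R. ennreal (((R *v e) \<bullet> z) ^ (2 * k) / fact (2 * k))) \<in> borel_measurable H"
        unfolding mH
        by (intro measurable_compose[OF _ measurable_ennreal] borel_measurable_continuous_onI continuous_intros) simp
      then show "(\<lambda>R. 2 * (ennreal (norm w ^ (2 * k)) * ennreal (((R *v e) \<bullet> z) ^ (2 * k) / fact (2 * k)))) \<in> borel_measurable H"
        by measurable
    qed
    also have "\<dots> = (\<Sum>k. 2 * (ennreal (norm w ^ (2 * k)) * c k))"
    proof -
      have "(\<lambda>R. ennreal (((R *v e) \<bullet> z) ^ (2 * k) / fact (2 * k))) \<in> borel_measurable H" for k
        unfolding mH
        by (intro measurable_compose[OF _ measurable_ennreal] borel_measurable_continuous_onI continuous_intros) simp
      then show ?thesis by (simp add: nn_integral_cmult c_def)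
    qed
    finally have "2 * (\<integral>\<^sup>+R. ennreal (exp ((R *v w) \<bullet> z)) \<partial>H) = 2 * (\<Sum>k. ennreal (norm w ^ (2 * k)) * c k)"
      by simp
    then show ?thesis by (simp add: ennreal_mult_cancel_left)
  qed
  have mp: "(\<lambda>p :: (real^'n) \<times> (real^'n^'n). ennreal (exp ((snd p *v fst p) \<bullet> z))) \<in> borel_measurable borel"
    by (intro measurable_compose[OF _ measurable_ennreal] borel_measurable_continuous_onI continuous_intros)
  have mp': "(\<lambda>(w, R). ennreal (exp ((R *v w) \<bullet> z))) \<in> borel_measurable (M \<Otimes>\<^sub>M H)"
    unfolding case_prod_unfold measurable_pair_borel[OF sM sH] by (rule mp)
  \<comment> \<open>A constant average over \<open>H\<close> is inserted; invariance of
    \<open>M\<close> then puts \<open>R\<close> in front of \<open>w\<close>, and Fubini brings the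
    Haar average inside.\<close>
  have "(\<integral>\<^sup>+w. ennreal (exp (w \<bullet> z)) \<partial>M) = (\<integral>\<^sup>+R. (\<integral>\<^sup>+w. ennreal (exp (w \<bullet> z)) \<partial>M) \<partial>H)"
    by (simp add: H.emeasure_space_1)
  also have "\<dots> = (\<integral>\<^sup>+R. (\<integral>\<^sup>+w. ennreal (exp ((R *v w) \<bullet> z)) \<partial>M) \<partial>H)"
  proof -
    have orth: "AE R in H. orthogonal_matrix R" using H by (simp add: haar_orthogonal_def)
    show ?thesis
    proof (rule nn_integral_cong_AE, use orth in eventually_elim)
      fix R :: "real^'n^'n" assume R: "orthogonal_matrix R"
      have mR: "(\<lambda>w. R *v w) \<in> borel_measurable M"
        unfolding mM by (intro borel_measurable_continuous_onI continuous_intros)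
      have "(\<integral>\<^sup>+w. ennreal (exp (w \<bullet> z)) \<partial>M) = (\<integral>\<^sup>+w. ennreal (exp (w \<bullet> z)) \<partial>distr M borel (\<lambda>w. R *v w))"
        by (simp only: inv[OF R])
      also have "\<dots> = (\<integral>\<^sup>+w. ennreal (exp ((R *v w) \<bullet> z)) \<partial>M)"
        by (subst nn_integral_distr[OF mR]) (simp_all add: me)
      finally show "(\<integral>\<^sup>+w. ennreal (exp (w \<bullet> z)) \<partial>M) = (\<integral>\<^sup>+w. ennreal (exp ((R *v w) \<bullet> z)) \<partial>M)" .
    qed
  qed
  also have "\<dots> = (\<integral>\<^sup>+w. (\<integral>\<^sup>+R. ennreal (exp ((R *v w) \<bullet> z)) \<partial>H) \<partial>M)"
    using Fubini[OF mp'] by simp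
  also have "\<dots> = (\<integral>\<^sup>+w. (\<Sum>k. ennreal (norm w ^ (2 * k)) * c k) \<partial>M)"
    by (simp only: average)
  also have "\<dots> = (\<Sum>k. \<integral>\<^sup>+w. ennreal (norm w ^ (2 * k)) * c k \<partial>M)"
    by (rule nn_integral_suminf) (simp add: mM)
  also have "\<dots> = (\<Sum>k. c k * (\<integral>\<^sup>+w. ennreal (norm w ^ (2 * k)) \<partial>M))"
    by (subst nn_integral_multc) (simp_all add: mM mult.commute)
  finally show ?thesis by (simp only: c_def)
qed

text \<open>The coefficients involve neither \<open>P\<close> nor the pair, so couplings differ only
  through the moments of the pair sums.\<close>

lemma wig_pair_mgf:
  fixes P :: "(real^'n::finite^'n) measure"
  assumes H: "haar_orthogonal H" and P: "wig_coupling P" and ij: "i \<noteq> j" and e: "norm e = 1"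
  shows "(\<integral>\<^sup>+W. ennreal (exp ((W $ i + W $ j) \<bullet> z)) \<partial>P)
    = (\<Sum>k. (\<integral>\<^sup>+R. ennreal (((R *v e) \<bullet> z) ^ (2 * k) / fact (2 * k)) \<partial>H) * (\<integral>\<^sup>+W. ennreal (norm (W $ i + W $ j) ^ (2 * k)) \<partial>P))"
proof -
  interpret P: prob_space P using wig_coupling_props(1)[OF P] .
  have sP: "sets P = sets borel" using wig_coupling_props(2)[OF P] .
  have m: "(\<lambda>W. W $ i + W $ j) \<in> borel_measurable P"
    unfolding measurable_cong_sets[OF sP refl] by (intro borel_measurable_continuous_onI continuous_intros)
  let ?M = "distr P borel (\<lambda>W. W $ i + W $ j)"
  have inv: "distr ?M borel (\<lambda>w. U *v w) = ?M" if U: "orthogonal_matrix U" for U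
  proof -
    have mU: "(\<lambda>w. U *v w) \<in> borel_measurable borel"
      by (intro borel_measurable_continuous_onI continuous_intros)
    have "distr ?M borel (\<lambda>w. U *v w) = distr P borel (\<lambda>W. U *v (W $ i + W $ j))"
      by (subst distr_distr[OF mU m]) (simp add: comp_def)
    then show ?thesis using P ij U by (simp add: wig_coupling_def)
  qed
  have me: "(\<lambda>w :: real^'n. ennreal (exp (w \<bullet> z))) \<in> borel_measurable borel"
    by (intro measurable_compose[OF _ measurable_ennreal] borel_measurable_continuous_onI continuous_intros)
  show ?thesis
    using rotation_invariant_mgf[OF H P.prob_space_distr[OF m] _ e inv, of z]
    by (simp add: nn_integral_distr[OF m] me)
qed

section \<open>First and second moments of the random feature estimator\<close>

lemma wig_marginal:
  fixes P :: "(real^'n::finite^'n) measure"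
  assumes P: "wig_coupling P" and f: "f \<in> borel_measurable borel"
  shows "(\<integral>\<^sup>+W. f (W $ i) \<partial>P) = (\<integral>\<^sup>+w. f w \<partial>std_gauss)"
proof -
  have m: "(\<lambda>W. W $ i) \<in> borel_measurable P"
    unfolding measurable_cong_sets[OF wig_coupling_props(2)[OF P] refl]
    by (intro borel_measurable_continuous_onI continuous_intros)
  have "(\<integral>\<^sup>+w. f w \<partial>std_gauss) = (\<integral>\<^sup>+w. f w \<partial>distr P borel (\<lambda>W. W $ i))"
    using P by (simp add: wig_coupling_def)
  also have "\<dots> = (\<integral>\<^sup>+W. f (W $ i) \<partial>P)"
    by (subst nn_integral_distr[OF m]) (simp_all add: f)
  finally show ?thesis by simp
qed

lemma prf_K_eq:
  fixes W :: "real^'n::finite^'n"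
  shows "prf_K W x y = exp (- (norm x)\<^sup>2 - (norm y)\<^sup>2) / real CARD('n) * (\<Sum>i\<in>UNIV. exp (W $ i \<bullet> (x + y)))"
proof -
  have "prf_K W x y = (\<Sum>i\<in>UNIV. prf_phi W x $ i * prf_phi W y $ i)"
    by (simp add: prf_K_def inner_vec_def)
  also have "\<dots> = (\<Sum>i\<in>UNIV. exp (- (norm x)\<^sup>2 - (norm y)\<^sup>2) / real CARD('n) * exp (W $ i \<bullet> (x + y)))"
    by (intro sum.cong refl)
       (simp add: prf_phi_def inner_add_right exp_add exp_diff exp_minus divide_simps flip: real_sqrt_mult)
  finally show ?thesis by (simp add: sum_distrib_left)
qed

text \<open>The diagonal terms of the squared sum involve single vectors, hence only the Gaussian
  marginals; the coupling enters through the off-diagonal terms, which are exponentials of pair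
  sums.\<close>

lemma prf_K_square:
  fixes W :: "real^'n::finite^'n"
  shows "(prf_K W x y)\<^sup>2 = (exp (- (norm x)\<^sup>2 - (norm y)\<^sup>2) / real CARD('n))\<^sup>2 *
    ((\<Sum>i\<in>UNIV. exp (W $ i \<bullet> (2 *\<^sub>R (x + y)))) + (\<Sum>p\<in>off_diagonal. exp ((W $ fst p + W $ snd p) \<bullet> (x + y))))"
proof -
  let ?g = "\<lambda>i. exp (W $ i \<bullet> (x + y))"
  have "(\<Sum>i\<in>UNIV. ?g i)\<^sup>2 = (\<Sum>i\<in>UNIV. \<Sum>j\<in>UNIV. ?g i * ?g j)"
    by (simp add: power2_eq_square sum_product)
  also have "\<dots> = (\<Sum>i\<in>UNIV. ?g i * ?g i + (\<Sum>j\<in>UNIV - {i}. ?g i * ?g j))"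
    by (intro sum.cong refl sum.remove) auto
  also have "\<dots> = (\<Sum>i\<in>UNIV. exp (W $ i \<bullet> (2 *\<^sub>R (x + y)))) + (\<Sum>p\<in>off_diagonal. exp ((W $ fst p + W $ snd p) \<bullet> (x + y)))"
    by (simp add: sum.distrib sum.Sigma case_prod_unfold inner_add_left flip: exp_add)
  finally show ?thesis by (simp only: prf_K_eq power_mult_distrib)
qed

lemma nn_integral_prf_K_square:
  fixes P :: "(real^'n::finite^'n) measure" and e :: "real^'n"
  assumes H: "haar_orthogonal H" and P: "wig_coupling P" and e: "norm e = 1"
  shows "(\<integral>\<^sup>+W. ennreal ((prf_K W x y)\<^sup>2) \<partial>P) = ennreal ((exp (- (norm x)\<^sup>2 - (norm y)\<^sup>2) / real CARD('n))\<^sup>2) *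
    (of_nat CARD('n) * (\<integral>\<^sup>+w. ennreal (exp (w \<bullet> (2 *\<^sub>R (x + y)))) \<partial>(std_gauss :: (real^'n) measure))
     + (\<Sum>p\<in>off_diagonal. \<Sum>k. (\<integral>\<^sup>+R. ennreal (((R *v e) \<bullet> (x + y)) ^ (2 * k) / fact (2 * k)) \<partial>H)
          * (\<integral>\<^sup>+W. ennreal (norm (W $ fst p + W $ snd p) ^ (2 * k)) \<partial>P)))"
proof -
  note mP = measurable_cong_sets[OF wig_coupling_props(2)[OF P] refl]
  have m1: "(\<lambda>W. ennreal (exp (W $ i \<bullet> (2 *\<^sub>R (x + y))))) \<in> borel_measurable P" for i
    unfolding mP
    by (intro measurable_compose[OF _ measurable_ennreal] borel_measurable_continuous_onI continuous_intros)
  have m2: "(\<lambda>W. ennreal (exp ((W $ fst p + W $ snd p) \<bullet> (x + y)))) \<in> borel_measurable P" for p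
    unfolding mP
    by (intro measurable_compose[OF _ measurable_ennreal] borel_measurable_continuous_onI continuous_intros)
  have m3: "(\<lambda>w :: real^'n. ennreal (exp (w \<bullet> (2 *\<^sub>R (x + y))))) \<in> borel_measurable borel"
    by (intro measurable_compose[OF _ measurable_ennreal] borel_measurable_continuous_onI continuous_intros)
  let ?c = "(exp (- (norm x)\<^sup>2 - (norm y)\<^sup>2) / real CARD('n))\<^sup>2"
  have "ennreal ((prf_K W x y)\<^sup>2) = ennreal ?c * ((\<Sum>i\<in>UNIV. ennreal (exp (W $ i \<bullet> (2 *\<^sub>R (x + y)))))
      + (\<Sum>p\<in>off_diagonal. ennreal (exp ((W $ fst p + W $ snd p) \<bullet> (x + y)))))" for W :: "real^'n^'n"
    unfolding prf_K_square by (subst ennreal_mult) (simp_all add: sum_nonneg ennreal_plus sum_ennreal)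
  then have "(\<integral>\<^sup>+W. ennreal ((prf_K W x y)\<^sup>2) \<partial>P)
    = (\<integral>\<^sup>+W. ennreal ?c * ((\<Sum>i\<in>UNIV. ennreal (exp (W $ i \<bullet> (2 *\<^sub>R (x + y)))))
      + (\<Sum>p\<in>off_diagonal. ennreal (exp ((W $ fst p + W $ snd p) \<bullet> (x + y))))) \<partial>P)"
    by (simp only:)
  also have "\<dots> = ennreal ?c * ((\<integral>\<^sup>+W. (\<Sum>i\<in>UNIV. ennreal (exp (W $ i \<bullet> (2 *\<^sub>R (x + y))))) \<partial>P)
      + (\<integral>\<^sup>+W. (\<Sum>p\<in>off_diagonal. ennreal (exp ((W $ fst p + W $ snd p) \<bullet> (x + y)))) \<partial>P))"
    by (subst nn_integral_cmult, intro borel_measurable_add borel_measurable_sum m1 m2,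
        subst nn_integral_add, (intro borel_measurable_sum m1 m2)+, rule refl)
  also have "\<dots> = ennreal ?c * ((\<Sum>i\<in>UNIV. \<integral>\<^sup>+W. ennreal (exp (W $ i \<bullet> (2 *\<^sub>R (x + y)))) \<partial>P)
      + (\<Sum>p\<in>off_diagonal. \<integral>\<^sup>+W. ennreal (exp ((W $ fst p + W $ snd p) \<bullet> (x + y))) \<partial>P))"
    by (intro arg_cong2[where f = "(+)"] arg_cong[where f = "(*) _"] nn_integral_sum m1 m2)
  also have "(\<Sum>i\<in>UNIV. \<integral>\<^sup>+W. ennreal (exp (W $ i \<bullet> (2 *\<^sub>R (x + y)))) \<partial>P)
      = of_nat CARD('n) * (\<integral>\<^sup>+w. ennreal (exp (w \<bullet> (2 *\<^sub>R (x + y)))) \<partial>std_gauss)"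
    by (simp add: wig_marginal[OF P m3] del: inner_scaleR_right)
  also have "(\<Sum>p\<in>off_diagonal. \<integral>\<^sup>+W. ennreal (exp ((W $ fst p + W $ snd p) \<bullet> (x + y))) \<partial>P)
      = (\<Sum>p\<in>off_diagonal. \<Sum>k. (\<integral>\<^sup>+R. ennreal (((R *v e) \<bullet> (x + y)) ^ (2 * k) / fact (2 * k)) \<partial>H)
          * (\<integral>\<^sup>+W. ennreal (norm (W $ fst p + W $ snd p) ^ (2 * k)) \<partial>P))"
    by (intro sum.cong refl wig_pair_mgf[OF H P _ e]) auto
  finally show ?thesis .
qed

text \<open>The right-hand side does not mention \<open>P\<close>: the mean of the estimator is the
  same for all couplings.\<close>

lemma nn_integral_prf_K:
  fixes P :: "(real^'n::finite^'n) measure"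
  assumes P: "wig_coupling P"
  shows "(\<integral>\<^sup>+W. ennreal (prf_K W x y) \<partial>P) = ennreal (exp (- (norm x)\<^sup>2 - (norm y)\<^sup>2) / real CARD('n)) *
    (of_nat CARD('n) * (\<integral>\<^sup>+w. ennreal (exp (w \<bullet> (x + y))) \<partial>(std_gauss :: (real^'n) measure)))"
proof -
  note mP = measurable_cong_sets[OF wig_coupling_props(2)[OF P] refl]
  have m1: "(\<lambda>W. ennreal (exp (W $ i \<bullet> (x + y)))) \<in> borel_measurable P" for i
    unfolding mP
    by (intro measurable_compose[OF _ measurable_ennreal] borel_measurable_continuous_onI continuous_intros)
  have m3: "(\<lambda>w :: real^'n. ennreal (exp (w \<bullet> (x + y)))) \<in> borel_measurable borel"
    by (intro measurable_compose[OF _ measurable_ennreal] borel_measurable_continuous_onI continuous_intros)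
  let ?c = "exp (- (norm x)\<^sup>2 - (norm y)\<^sup>2) / real CARD('n)"
  have "ennreal (prf_K W x y) = ennreal ?c * (\<Sum>i\<in>UNIV. ennreal (exp (W $ i \<bullet> (x + y))))" for W :: "real^'n^'n"
    unfolding prf_K_eq by (subst ennreal_mult) (simp_all add: sum_nonneg sum_ennreal)
  then have "(\<integral>\<^sup>+W. ennreal (prf_K W x y) \<partial>P) = ennreal ?c * (\<Sum>i\<in>UNIV. \<integral>\<^sup>+W. ennreal (exp (W $ i \<bullet> (x + y))) \<partial>P)"
    by (simp add: nn_integral_cmult nn_integral_sum m1 borel_measurable_sum del: sum_ennreal)
  then show ?thesis by (simp add: wig_marginal[OF P m3])
qed

lemma nn_integral_prf_K_finite:
  fixes P :: "(real^'n::finite^'n) measure"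
  assumes P: "wig_coupling P"
  shows "(\<integral>\<^sup>+W. ennreal (prf_K W x y) \<partial>P) < \<infinity>"
  unfolding nn_integral_prf_K[OF P] using std_gauss_mgf_finite[of "x + y"]
  by (simp add: ennreal_mult_less_top of_nat_less_top)

text \<open>Expansion of the square, with the cross term on the left because subtraction in
  \<open>ennreal\<close> is truncated.\<close>

lemma prf_mse_expand:
  fixes P :: "(real^'n::finite^'n) measure"
  assumes P: "wig_coupling P"
  shows "2 * ennreal (exp (- (norm (x - y))\<^sup>2 / 2)) * (\<integral>\<^sup>+W. ennreal (prf_K W x y) \<partial>P) + prf_mse P x y
    = (\<integral>\<^sup>+W. ennreal ((prf_K W x y)\<^sup>2) \<partial>P) + ennreal ((exp (- (norm (x - y))\<^sup>2 / 2))\<^sup>2)"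
proof -
  interpret P: prob_space P using wig_coupling_props(1)[OF P] .
  let ?K = "exp (- (norm (x - y))\<^sup>2 / 2)"
  have mK: "(\<lambda>W :: real^'n^'n. prf_K W x y) \<in> borel_measurable P"
    unfolding measurable_cong_sets[OF wig_coupling_props(2)[OF P] refl] prf_K_eq
    by (intro borel_measurable_continuous_onI continuous_intros)
  have K0: "0 \<le> prf_K W x y" for W :: "real^'n^'n"
    unfolding prf_K_eq by (simp add: sum_nonneg)
  have "2 * ennreal ?K * (\<integral>\<^sup>+W. ennreal (prf_K W x y) \<partial>P) + prf_mse P x y
      = (\<integral>\<^sup>+W. 2 * ennreal ?K * ennreal (prf_K W x y) + ennreal ((prf_K W x y - ?K)\<^sup>2) \<partial>P)"
    unfolding prf_mse_def using mK by (subst nn_integral_add) (simp_all add: nn_integral_cmult)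
  also have "\<dots> = (\<integral>\<^sup>+W. ennreal ((prf_K W x y)\<^sup>2) + ennreal (?K\<^sup>2) \<partial>P)"
  proof (rule nn_integral_cong)
    fix W :: "real^'n^'n"
    have "2 * ennreal ?K * ennreal (prf_K W x y) + ennreal ((prf_K W x y - ?K)\<^sup>2)
        = ennreal (2 * ?K * prf_K W x y + (prf_K W x y - ?K)\<^sup>2)"
      using K0[of W] by (simp add: ennreal_plus ennreal_mult)
    also have "2 * ?K * prf_K W x y + (prf_K W x y - ?K)\<^sup>2 = (prf_K W x y)\<^sup>2 + ?K\<^sup>2"
      by (simp add: power2_eq_square algebra_simps)
    finally show "2 * ennreal ?K * ennreal (prf_K W x y) + ennreal ((prf_K W x y - ?K)\<^sup>2)
        = ennreal ((prf_K W x y)\<^sup>2) + ennreal (?K\<^sup>2)"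
      by (simp add: ennreal_plus)
  qed
  also have "\<dots> = (\<integral>\<^sup>+W. ennreal ((prf_K W x y)\<^sup>2) \<partial>P) + ennreal (?K\<^sup>2)"
    using mK by (subst nn_integral_add) (simp_all add: P.emeasure_space_1)
  finally show ?thesis .
qed

text \<open>Gamma is positive at the arguments involved, so all terms are nonnegative and the series
  can be integrated term by term.\<close>

lemma rf_conformity_series:
  fixes P :: "(real^'n::finite^'n) measure"
  assumes sP: "sets P = sets borel"
  shows "rf_conformity P x y =
    ennreal (Gamma (real CARD('n) / 2) / (real CARD('n) * (real CARD('n) - 1))) *
    (\<Sum>p\<in>off_diagonal. \<Sum>k. ennreal (norm (x + y) ^ (2 * k) / (2 ^ (2 * k) * fact k * Gamma (real k + real CARD('n) / 2)))
      * (\<integral>\<^sup>+W. ennreal (norm (W $ fst p + W $ snd p) ^ (2 * k)) \<partial>P))"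
proof -
  let ?c = "\<lambda>k. norm (x + y) ^ (2 * k) / (2 ^ (2 * k) * fact k * Gamma (real k + real CARD('n) / 2))"
  have c: "0 \<le> ?c k" for k
  proof -
    have "Gamma (real k + real CARD('n) / 2) > 0"
      by (intro Gamma_real_pos add_nonneg_pos) simp_all
    then show ?thesis by simp
  qed
  have "(\<integral>\<^sup>+W. (\<Sum>k. ennreal (norm (x + y) ^ (2 * k) * norm (W $ i + W $ j) ^ (2 * k)
        / (2 ^ (2 * k) * fact k * Gamma (real k + real CARD('n) / 2)))) \<partial>P)
      = (\<Sum>k. ennreal (?c k) * (\<integral>\<^sup>+W. ennreal (norm (W $ i + W $ j) ^ (2 * k)) \<partial>P))" for i j
  proof -
    have m: "(\<lambda>W. ennreal (norm (W $ i + W $ j) ^ (2 * k))) \<in> borel_measurable P" for k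
      unfolding measurable_cong_sets[OF sP refl]
      by (intro measurable_compose[OF _ measurable_ennreal] borel_measurable_continuous_onI continuous_intros)
    have "ennreal (norm (x + y) ^ (2 * k) * norm (W $ i + W $ j) ^ (2 * k)
        / (2 ^ (2 * k) * fact k * Gamma (real k + real CARD('n) / 2))) = ennreal (?c k) * ennreal (norm (W $ i + W $ j) ^ (2 * k))"
      for k and W :: "real^'n^'n"
      by (subst ennreal_mult[symmetric]) (use c in auto)
    then have "(\<integral>\<^sup>+W. (\<Sum>k. ennreal (norm (x + y) ^ (2 * k) * norm (W $ i + W $ j) ^ (2 * k)
        / (2 ^ (2 * k) * fact k * Gamma (real k + real CARD('n) / 2)))) \<partial>P)
      = (\<integral>\<^sup>+W. (\<Sum>k. ennreal (?c k) * ennreal (norm (W $ i + W $ j) ^ (2 * k))) \<partial>P)"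
      by (simp only:)
    also have "\<dots> = (\<Sum>k. \<integral>\<^sup>+W. ennreal (?c k) * ennreal (norm (W $ i + W $ j) ^ (2 * k)) \<partial>P)"
      by (intro nn_integral_suminf borel_measurable_times_ennreal borel_measurable_const m)
    also have "\<dots> = (\<Sum>k. ennreal (?c k) * (\<integral>\<^sup>+W. ennreal (norm (W $ i + W $ j) ^ (2 * k)) \<partial>P))"
      by (intro suminf_cong nn_integral_cmult m)
    finally show ?thesis .
  qed
  then show ?thesis
    unfolding rf_conformity_def by (simp add: sum.Sigma case_prod_unfold)
qed

theorem theorem3p4:
  fixes H :: "((real^('n::{finite,linorder}))^('n::{finite,linorder})) measure"
  assumes "CARD('n) \<ge> 2"
    and "haar_orthogonal H"
  shows "wig_coupling (simrf H) \<and>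
    (\<forall>P x y. wig_coupling P \<longrightarrow>
       rf_conformity (simrf H) x y \<le> rf_conformity P x y \<and>
       prf_mse (simrf H) x y \<le> prf_mse P x y)"
proof (intro conjI allI impI)
  note n = assms(1) and H = assms(2)
  show S: "wig_coupling (simrf H)" by (rule wig_coupling_simrf[OF n H])
  fix P :: "((real^('n::{finite,linorder}))^('n::{finite,linorder})) measure" and x y
  assume P: "wig_coupling P"
  show "rf_conformity (simrf H) x y \<le> rf_conformity P x y"
    unfolding rf_conformity_series[OF wig_coupling_props(2)[OF S]] rf_conformity_series[OF wig_coupling_props(2)[OF P]]
    by (intro mult_left_mono simrf_pair_series_le[OF n H P]) simp
  let ?K = "exp (- (norm (x - y))\<^sup>2 / 2)"
  \<comment> \<open>Any unit vector would do; using the same one for both couplings gives identical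
    series coefficients.\<close>
  have e: "norm (axis undefined 1 :: real^('n::{finite,linorder})) = 1" by simp
  have "(\<integral>\<^sup>+W. ennreal ((prf_K W x y)\<^sup>2) \<partial>simrf H) \<le> (\<integral>\<^sup>+W. ennreal ((prf_K W x y)\<^sup>2) \<partial>P)"
    unfolding nn_integral_prf_K_square[OF H S e] nn_integral_prf_K_square[OF H P e]
    by (intro mult_left_mono add_left_mono simrf_pair_series_le[OF n H P]) simp
  then have "2 * ennreal ?K * (\<integral>\<^sup>+W. ennreal (prf_K W x y) \<partial>simrf H) + prf_mse (simrf H) x y
      \<le> 2 * ennreal ?K * (\<integral>\<^sup>+W. ennreal (prf_K W x y) \<partial>P) + prf_mse P x y"
    unfolding prf_mse_expand[OF S] prf_mse_expand[OF P] by (rule add_right_mono)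
  moreover have "(\<integral>\<^sup>+W. ennreal (prf_K W x y) \<partial>simrf H) = (\<integral>\<^sup>+W. ennreal (prf_K W x y) \<partial>P)"
    by (simp only: nn_integral_prf_K[OF S] nn_integral_prf_K[OF P])
  \<comment> \<open>The cross terms of the two couplings agree, and being finite they can be
    cancelled in \<open>ennreal\<close>.\<close>
  moreover have "2 * ennreal ?K * (\<integral>\<^sup>+W. ennreal (prf_K W x y) \<partial>P) \<noteq> \<infinity>"
    using nn_integral_prf_K_finite[OF P, of x y]
    by (simp add: ennreal_mult_eq_top_iff)
  ultimately show "prf_mse (simrf H) x y \<le> prf_mse P x y"
    by (simp add: ennreal_add_left_cancel_le)
qed

end
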